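(* Assume A1–A5 and $k_n\asymp n^{2-4r}$, where $0<r<1/2$ and $s=\frac{r}{2-4r}$. Then the balls $U=\bar{\mathbb B}^s_{2\infty}(P_0)$, $P_0>0$, are completely perfect maxisets for the test statistics $T_n(Y_n)$; that is, for $0<\alpha<1$ and a sequence of tests $K_n$ generated by $T_n$ with $\alpha(K_n)=\alpha(1+o(1))$: for any $\epsilon>0$ and any constants $0<c<C$ there are $\gamma_\epsilon$ and $n_\epsilon$ such that, if a sequence of alternatives $f_n\in\mathbb L_2(0,1)$ with $cn^{-r}\le\|f_n\|\le Cn^{-r}$ is consistent, then for all $n>n_\epsilon$ and all $\gamma>\gamma_\epsilon$ $$|\beta(K_n,f_n)-\beta(K_n,f_{n\gamma})|\le\epsilon\quad\text{and}\quad \beta(K_n,f_n-f_{n\gamma})\ge1-\alpha-\epsilon .$$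
   Context: Model: one observes $dY_n(t)=f(t)dt+\frac{\sigma}{\sqrt n}dw(t)$, $t\in[0,1]$, $\sigma>0$, $f\in\mathbb L_2(0,1)$ unknown, $dw$ Gaussian white noise; $\|\cdot\|$ is the $\mathbb L_2(0,1)$ norm. $\phi_j$, $1\le j<\infty$, is an orthonormal basis of $\mathbb L_2(0,1)$, $\theta_j=\int f\phi_j\,dt$, $y_j=\int\phi_j\,dY_n=\theta_j+\frac{\sigma}{\sqrt n}\xi_j$ with $\xi_j$ i.i.d. $N(0,1)$. The hypothesis is $H_0:f=0$. $\alpha(K_n)$ and $\beta(K_n,f)$ are the type I error probability and the type II error probability at $f$ of a test $K_n$. A test is generated by $T_n$ if it rejects $H_0$ when $T_n$ exceeds a threshold. A sequence of alternatives $f_n$ is consistent if there is a sequence of tests $K_n$ generated by $T_n$ with $\limsup_{n\to\infty}(\alpha(K_n)+\beta(K_n,f_n))<1$. $a_n\asymp b_n$ means $ca_n\le b_n\le Ca_n$ for all $n$ with constants $0<c\le C$. Test statistics: $T_n(Y_n)=\sum_{j=1}^\infty\kappa_{jn}^2y_j^2-\sigma^2n^{-1}\sum_{j=1}^\infty\kappa_{jn}^2$, with $k_n=\sup\{k:\sum_{j<k}\kappa_{jn}^2\le\frac12\sum_{j=1}^\infty\kappa_{jn}^2\}$. Non-integer indices are replaced by integer parts. Assumptions: A1. For each $n$ the sequence $\kappa^2_{jn}$ is decreasing in $j$. A2. There are positive constants $C_1,C_2$ with $C_1<A_n=\sigma^{-4}n^2\sum_{j=1}^\infty\kappa_{jn}^4<C_2$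 for each $n$. A3. For any $0<\delta<1/2$, $\lim_{n\to\infty}\sup_{\delta k_n<j<\delta^{-1}k_n}\left|\kappa^2_{j+1,n}/\kappa^2_{j,n}-1\right|=0$. A4. For any $\delta>0$ and any $0\le\delta_1<1$ there are constants $C_1>0$ and $C_2<1$ with $C_1<\kappa^2_{(1+\delta)k_n,n}/\kappa^2_{(1-\delta_1)k_n,n}<C_2$. A5. $\lim_{\delta\to0}\lim_{n\to\infty}\frac{\sum_{\delta k_n<j<\delta^{-1}k_n}\kappa_{jn}^2}{\sum_{j=1}^\infty\kappa_{jn}^2}=1$ and $\lim_{\delta\to0}\lim_{n\to\infty}A_n^{-1}\sigma^{-4}n^2\sum_{\delta k_n<j<\delta^{-1}k_n}\kappa_{jn}^4=1$. Balls: $\bar{\mathbb B}^s_{2\infty}(P_0)=\{f=\sum_{j\ge1}\theta_j\phi_j:\ \sup_{\lambda>0}\lambda^{2s}\sum_{j>\lambda}\theta_j^2\le P_0,\ \theta_j\in\mathbb R\}$, and $\gamma U=\{\gamma g:g\in U\}$. For $\gamma>0$, $f_{n\gamma}\in\gamma U$ is the point of $\gamma U$ nearest to $f_n$: $\|f_{n\gamma}-f_n\|=\inf\{\|g-f_n\|:g\in\gamma U\}$. *)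

theory Defs
  imports "HOL-Probability.Probability" "HOL-Library.Landau_Symbols"
begin

text \<open>
  Coordinates are numbered from 1: the entry at 0 of a sequence indexed by \<open>j\<close> is never used.
  Likewise the sample index \<open>n\<close> ranges over \<open>n \<ge> 1\<close>.
\<close>

subsection \<open>The space of square integrable functions on the unit interval\<close>

definition L2_01 :: "(real \<Rightarrow> real) set" where
  "L2_01 = {f. f \<in> borel_measurable (lebesgue_on {0<..<1}) \<and>
               integrable (lebesgue_on {0<..<1}) (\<lambda>t. (f t)\<^sup>2)}"

definition L2_inner :: "(real \<Rightarrow> real) \<Rightarrow> (real \<Rightarrow> real) \<Rightarrow> real" where
  "L2_inner f g = (LINT t|lebesgue_on {0<..<1}. f t * g t)"

definition L2_norm :: "(real \<Rightarrow> real) \<Rightarrow> real" where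
  "L2_norm f = sqrt (LINT t|lebesgue_on {0<..<1}. (f t)\<^sup>2)"

definition L2_expansion :: "(nat \<Rightarrow> real \<Rightarrow> real) \<Rightarrow> (nat \<Rightarrow> real) \<Rightarrow> (real \<Rightarrow> real) \<Rightarrow> bool" where
  "L2_expansion \<phi> \<theta> f \<longleftrightarrow>
     (\<lambda>N. L2_norm (\<lambda>t. f t - (\<Sum>j=1..N. \<theta> j * \<phi> j t))) \<longlonglongrightarrow> 0"

definition orthonormal_basis :: "(nat \<Rightarrow> real \<Rightarrow> real) \<Rightarrow> bool" where
  "orthonormal_basis \<phi> \<longleftrightarrow>
     (\<forall>j\<ge>1. \<phi> j \<in> L2_01) \<and>
     (\<forall>i\<ge>1. \<forall>j\<ge>1. L2_inner (\<phi> i) (\<phi> j) = (if i = j then 1 else 0)) \<and>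
     (\<forall>f\<in>L2_01. L2_expansion \<phi> (\<lambda>j. L2_inner f (\<phi> j)) f)"

text \<open>
  The bound on the supremum over \<open>x > 0\<close> is stated pointwise. Since \<open>f\<close> is square integrable, the
  coefficients of an expansion in an orthonormal basis are square summable, so the sum below
  is never the default value 0 of a divergent \<open>infsum\<close>.
\<close>

definition Besov_ball ::
    "(nat \<Rightarrow> real \<Rightarrow> real) \<Rightarrow> real \<Rightarrow> real \<Rightarrow> (real \<Rightarrow> real) set" where
  "Besov_ball \<phi> s P0 = {f \<in> L2_01. \<exists>\<theta>. L2_expansion \<phi> \<theta> f \<and>
     (\<forall>x>0. x powr (2 * s) * (\<Sum>\<^sub>\<infinity>j\<in>{j. 1 \<le> j \<and> x < real j}. (\<theta> j)\<^sup>2) \<le> P0)}"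

definition dilate :: "real \<Rightarrow> (real \<Rightarrow> real) set \<Rightarrow> (real \<Rightarrow> real) set" where
  "dilate \<gamma> U = (\<lambda>g t. \<gamma> * g t) ` U"

text \<open>Functions are not identified up to null sets, so a nearest point is unique only almost
  everywhere; hence a predicate.\<close>

definition nearest_point :: "(real \<Rightarrow> real) set \<Rightarrow> (real \<Rightarrow> real) \<Rightarrow> (real \<Rightarrow> real) \<Rightarrow> bool" where
  "nearest_point V f g \<longleftrightarrow>
     g \<in> V \<and> L2_norm (\<lambda>t. g t - f t) = (INF h\<in>V. L2_norm (\<lambda>t. h t - f t))"

subsection \<open>Observations and tests\<close>

definition observation ::
    "(nat \<Rightarrow> 'w \<Rightarrow> real) \<Rightarrow> real \<Rightarrow> (nat \<Rightarrow> real \<Rightarrow> real) \<Rightarrow> nat \<Rightarrow> (real \<Rightarrow> real) \<Rightarrow> 'w \<Rightarrow> nat \<Rightarrow> real" where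
  "observation \<xi> \<sigma> \<phi> n f \<omega> j = L2_inner f (\<phi> j) + \<sigma> / sqrt (real n) * \<xi> j \<omega>"

definition iid_std_normal :: "'w measure \<Rightarrow> (nat \<Rightarrow> 'w \<Rightarrow> real) \<Rightarrow> bool" where
  "iid_std_normal M \<xi> \<longleftrightarrow>
     prob_space M \<and>
     prob_space.indep_vars M (\<lambda>_. borel) \<xi> {1..} \<and>
     (\<forall>j\<ge>1. distributed M lborel (\<xi> j) (\<lambda>x. ennreal (std_normal_density x)))"

text \<open>A (nonrandomized) test is a predicate on the observed coordinates; it holds where the
  hypothesis \<open>f = 0\<close> is rejected.\<close>

type_synonym test = "(nat \<Rightarrow> real) \<Rightarrow> bool"

definition type1_error ::
    "'w measure \<Rightarrow> (nat \<Rightarrow> 'w \<Rightarrow> real) \<Rightarrow> real \<Rightarrow> (nat \<Rightarrow> real \<Rightarrow> real) \<Rightarrow> nat \<Rightarrow> test \<Rightarrow> real" where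
  "type1_error M \<xi> \<sigma> \<phi> n K =
     measure M {\<omega> \<in> space M. K (observation \<xi> \<sigma> \<phi> n (\<lambda>t. 0) \<omega>)}"

definition type2_error ::
    "'w measure \<Rightarrow> (nat \<Rightarrow> 'w \<Rightarrow> real) \<Rightarrow> real \<Rightarrow> (nat \<Rightarrow> real \<Rightarrow> real) \<Rightarrow> nat \<Rightarrow> test \<Rightarrow>
     (real \<Rightarrow> real) \<Rightarrow> real" where
  "type2_error M \<xi> \<sigma> \<phi> n K f =
     measure M {\<omega> \<in> space M. \<not> K (observation \<xi> \<sigma> \<phi> n f \<omega>)}"

definition T_stat :: "real \<Rightarrow> (nat \<Rightarrow> nat \<Rightarrow> real) \<Rightarrow> nat \<Rightarrow> (nat \<Rightarrow> real) \<Rightarrow> real" where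
  "T_stat \<sigma> \<kappa> n y =
     (\<Sum>\<^sub>\<infinity>j\<in>{1..}. (\<kappa> j n)\<^sup>2 * (y j)\<^sup>2) - \<sigma>\<^sup>2 / real n * (\<Sum>\<^sub>\<infinity>j\<in>{1..}. (\<kappa> j n)\<^sup>2)"

definition generated_tests :: "real \<Rightarrow> (nat \<Rightarrow> nat \<Rightarrow> real) \<Rightarrow> (nat \<Rightarrow> test) \<Rightarrow> bool" where
  "generated_tests \<sigma> \<kappa> K \<longleftrightarrow> (\<forall>n\<ge>1. \<exists>u. \<forall>y. K n y \<longleftrightarrow> T_stat \<sigma> \<kappa> n y > u)"

definition consistent_alternatives ::
    "'w measure \<Rightarrow> (nat \<Rightarrow> 'w \<Rightarrow> real) \<Rightarrow> real \<Rightarrow> (nat \<Rightarrow> real \<Rightarrow> real) \<Rightarrow> (nat \<Rightarrow> nat \<Rightarrow> real) \<Rightarrow>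
     (nat \<Rightarrow> real \<Rightarrow> real) \<Rightarrow> bool" where
  "consistent_alternatives M \<xi> \<sigma> \<phi> \<kappa> f \<longleftrightarrow>
     (\<exists>K. generated_tests \<sigma> \<kappa> K \<and>
       limsup (\<lambda>n. ereal (type1_error M \<xi> \<sigma> \<phi> n (K n) + type2_error M \<xi> \<sigma> \<phi> n (K n) (f n))) < 1)"

subsection \<open>Assumptions on the coefficients\<close>

definition k_seq :: "(nat \<Rightarrow> nat \<Rightarrow> real) \<Rightarrow> nat \<Rightarrow> nat" where
  "k_seq \<kappa> n = Sup {k. (\<Sum>j\<in>{1..<k}. (\<kappa> j n)\<^sup>2) \<le> 1 / 2 * (\<Sum>\<^sub>\<infinity>j\<in>{1..}. (\<kappa> j n)\<^sup>2)}"

definition A_seq :: "real \<Rightarrow> (nat \<Rightarrow> nat \<Rightarrow> real) \<Rightarrow> nat \<Rightarrow> real" where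
  "A_seq \<sigma> \<kappa> n = (real n)\<^sup>2 / \<sigma> ^ 4 * (\<Sum>\<^sub>\<infinity>j\<in>{1..}. (\<kappa> j n) ^ 4)"

definition window :: "(nat \<Rightarrow> nat \<Rightarrow> real) \<Rightarrow> real \<Rightarrow> nat \<Rightarrow> nat set" where
  "window \<kappa> \<delta> n =
     {j. \<delta> * real (k_seq \<kappa> n) < real j \<and> real j < real (k_seq \<kappa> n) / \<delta>}"

definition asymp_order :: "(nat \<Rightarrow> real) \<Rightarrow> (nat \<Rightarrow> real) \<Rightarrow> bool" where
  "asymp_order a b \<longleftrightarrow> (\<exists>c C. 0 < c \<and> c \<le> C \<and> (\<forall>n\<ge>1. c * a n \<le> b n \<and> b n \<le> C * a n))"

text \<open>\<open>lim\<^bsub>\<delta>\<rightarrow>0\<^esub> lim\<^bsub>n\<rightarrow>\<infinity>\<^esub> F \<delta> n = l\<close>, including existence of the inner limits for all small \<open>\<delta> > 0\<close>\<close>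

definition iterated_limit :: "(real \<Rightarrow> nat \<Rightarrow> real) \<Rightarrow> real \<Rightarrow> bool" where
  "iterated_limit F l \<longleftrightarrow>
     (\<exists>L. (\<forall>\<^sub>F \<delta> in at_right 0. F \<delta> \<longlonglongrightarrow> L \<delta>) \<and> (L \<longlongrightarrow> l) (at_right 0))"

definition A1 :: "(nat \<Rightarrow> nat \<Rightarrow> real) \<Rightarrow> bool" where
  "A1 \<kappa> \<longleftrightarrow> (\<forall>n\<ge>1. \<forall>j\<ge>1. (\<kappa> (Suc j) n)\<^sup>2 \<le> (\<kappa> j n)\<^sup>2)"

definition A2 :: "real \<Rightarrow> (nat \<Rightarrow> nat \<Rightarrow> real) \<Rightarrow> bool" where
  "A2 \<sigma> \<kappa> \<longleftrightarrow> (\<exists>C1>0. \<exists>C2>0. \<forall>n\<ge>1. C1 < A_seq \<sigma> \<kappa> n \<and> A_seq \<sigma> \<kappa> n < C2)"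

definition A3 :: "(nat \<Rightarrow> nat \<Rightarrow> real) \<Rightarrow> bool" where
  "A3 \<kappa> \<longleftrightarrow> (\<forall>\<delta>. 0 < \<delta> \<and> \<delta> < 1 / 2 \<longrightarrow>
     (\<lambda>n. SUP j\<in>window \<kappa> \<delta> n. \<bar>(\<kappa> (j + 1) n)\<^sup>2 / (\<kappa> j n)\<^sup>2 - 1\<bar>) \<longlonglongrightarrow> 0)"

text \<open>
  The bounds in \<open>A4\<close> are asked for all large \<open>n\<close>. They cannot hold for every \<open>n\<close>: for
  \<open>\<delta>\<^sub>1 = 0\<close> and \<open>\<delta> < 1 / k\<^sub>n\<close> both integer parts equal \<open>k\<^sub>n\<close>, so the ratio is not in \<open>(0, 1)\<close>;
  and \<open>(1 - \<delta>\<^sub>1) k\<^sub>n\<close> may be smaller than the first index 1.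
\<close>

definition A4 :: "(nat \<Rightarrow> nat \<Rightarrow> real) \<Rightarrow> bool" where
  "A4 \<kappa> \<longleftrightarrow> (\<forall>\<delta> \<delta>1. 0 < \<delta> \<and> 0 \<le> \<delta>1 \<and> \<delta>1 < 1 \<longrightarrow>
     (\<exists>C1>0. \<exists>C2<1. \<forall>\<^sub>F n in sequentially.
        (let q = (\<kappa> (nat \<lfloor>(1 + \<delta>) * real (k_seq \<kappa> n)\<rfloor>) n)\<^sup>2 /
                 (\<kappa> (nat \<lfloor>(1 - \<delta>1) * real (k_seq \<kappa> n)\<rfloor>) n)\<^sup>2
         in C1 < q \<and> q < C2)))"

definition A5 :: "real \<Rightarrow> (nat \<Rightarrow> nat \<Rightarrow> real) \<Rightarrow> bool" where
  "A5 \<sigma> \<kappa> \<longleftrightarrow>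
     iterated_limit
       (\<lambda>\<delta> n. (\<Sum>j\<in>window \<kappa> \<delta> n. (\<kappa> j n)\<^sup>2) / (\<Sum>\<^sub>\<infinity>j\<in>{1..}. (\<kappa> j n)\<^sup>2)) 1 \<and>
     iterated_limit
       (\<lambda>\<delta> n. inverse (A_seq \<sigma> \<kappa> n) * ((real n)\<^sup>2 / \<sigma> ^ 4 *
                (\<Sum>j\<in>window \<kappa> \<delta> n. (\<kappa> j n) ^ 4))) 1"

end

theory Submission
  imports Defs
begin

text \<open>
  For large \<open>\<gamma>\<close> the nearest point of the dilated ball has the same coordinates as \<open>f\<close> up to an index
  \<open>m\<close> of order \<open>D * n powr (2 - 4 * r)\<close>, with \<open>D\<close> large, and beyond \<open>m\<close> its coordinates are those of
  \<open>f\<close> shrunk towards 0. Beyond \<open>m\<close> the weights \<open>\<kappa>\<^sup>2\<close> are so small that, by Chebyshev's inequality,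
  changing these coordinates moves the test statistic by at most a small multiple of \<open>1 / n\<^sup>2\<close> with
  probability close to 1. The statistic is spread out on exactly this scale, whatever the
  alternative: the characteristic function of each noncentral chi-square summand is bounded by the
  modulus of the central one, and the product of about \<open>k_seq \<kappa> n\<close> such factors is integrable, so
  an interval of length \<open>\<eta> / n\<^sup>2\<close> has probability of order \<open>\<eta>\<close>. Hence the type II error hardly changes
  when \<open>f\<close> is replaced by the nearest point, and likewise when the difference is replaced by 0.
\<close>

subsection \<open>Anti-concentration of weighted noncentral chi-square sums\<close>

text \<open>The orders fit together as follows. Monotonicity and \<open>A2\<close> make
  \<open>\<kappa>\<^sup>2\<close> at index \<open>m\<close> at most of order
  \<open>1 / (n * sqrt m)\<close>. With \<open>m\<close> of order
  \<open>D * n powr (2 - 4 * r)\<close> and a squared norm of order \<open>n powr (- 2 * r)\<close>,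
  the product is of order \<open>1 / (n\<^sup>2 * sqrt D)\<close>: the power of \<open>n\<close> is
  that of the spread of the statistic, and \<open>D\<close> is left to make it small. In the ball,
  \<open>m powr (2 * s)\<close> times the squared norm is of order \<open>D powr (2 * s)\<close>;
  here \<open>n\<close> cancels exactly because \<open>s = r / (2 - 4 * r)\<close>, so one \<gamma>
  serves all \<open>n\<close>. The obstacle is uniformity: the thresholds for \<gamma> and
  \<open>n\<close> are fixed before the alternatives, and nothing is known about the critical
  values. Hence an explicit concentration bound valid for every shift and every critical value takes
  the place of a limit law. The modulus of a single characteristic function decays only like the
  inverse square root of its argument, which is not integrable; this is why coordinates are counted
  in groups of four.\<close>

lemma lborel_integral_inverse_one_plus_square:
  fixes a :: real
  assumes "a > 0"
  shows "integrable lborel (\<lambda>t. 1 / (1 + (a * t)\<^sup>2))"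
    and "(LBINT t. 1 / (1 + (a * t)\<^sup>2)) = pi / a"
proof -
  have i: "set_integrable lborel {0<..} (\<lambda>t::real. 1 / (1 + t\<^sup>2))"
    using integrable_I0i_1_div_plus_square
    by (simp add: interval_lebesgue_integrable_def inverse_eq_divide zero_ereal_def)
  have v: "(LBINT t:{0<..}. 1 / (1 + t\<^sup>2)) = pi / 2"
    using LBINT_I0i_1_div_plus_square
    by (simp add: interval_lebesgue_integral_0_infty inverse_eq_divide)
  \<comment> \<open>The arctangent integral is over the open half line, the rule for even functions
    wants the closed one; they differ in a null set.\<close>
  have ae: "AE t::real in lborel. indicator {0<..} t *\<^sub>R (1 / (1 + t\<^sup>2)) = indicator {0..} t *\<^sub>R (1 / (1 + t\<^sup>2))"
    using AE_lborel_singleton[of 0] by eventually_elim (auto simp: indicator_def)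
  have h0: "has_bochner_integral lborel (\<lambda>t::real. indicator {0..} t *\<^sub>R (1 / (1 + t\<^sup>2))) (pi / 2)"
    using i v ae unfolding set_integrable_def set_lebesgue_integral_def
    by (subst has_bochner_integral_cong_AE[OF _ _ ae[THEN AE_symmetric]])
       (auto simp: has_bochner_integral_iff)
  have "has_bochner_integral lborel (\<lambda>t::real. 1 / (1 + t\<^sup>2)) (2 * (pi / 2))"
    using has_bochner_integral_even_function[OF h0] by simp
  then have "has_bochner_integral lborel (\<lambda>t::real. 1 / (1 + t\<^sup>2)) pi" by simp
  from lborel_has_bochner_integral_real_affine_iff[of a "\<lambda>t. 1 / (1 + t\<^sup>2)" pi 0] assms this
  have "has_bochner_integral lborel (\<lambda>t. 1 / (1 + (a * t)\<^sup>2)) (pi / a)"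
    by (simp add: divide_inverse mult.commute)
  then show "integrable lborel (\<lambda>t. 1 / (1 + (a * t)\<^sup>2))"
    and "(LBINT t. 1 / (1 + (a * t)\<^sup>2)) = pi / a"
    by (auto simp: has_bochner_integral_iff)
qed

text \<open>The indicator of \<open>[- h, h]\<close> is at most \<open>exp (1 / 2)\<close> times \<open>exp (- x\<^sup>2 / (2 * h\<^sup>2))\<close>, which is
  itself a characteristic function; the resulting constant \<open>exp (1 / 2) / sqrt (2 * pi)\<close> is at most 1.\<close>

lemma (in prob_space) concentration_le_integral_char:
  fixes X :: "'a \<Rightarrow> real" and B :: "real \<Rightarrow> real"
  assumes X[measurable]: "random_variable borel X" and h: "h > 0"
    and B: "integrable lborel B" "\<And>t. norm (char (distr M borel X) t) \<le> B t"
  shows "prob {\<omega> \<in> space M. \<bar>X \<omega> - s\<bar> \<le> h} \<le> h * (LBINT t. B t)"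
proof -
  let ?N = "std_normal_distribution"
  interpret N: real_distribution ?N by (rule real_dist_normal_dist)
  interpret P: pair_prob_space M ?N ..
  interpret XD: real_distribution "distr M borel X" by (rule real_distribution_distr) simp
  let ?g = "\<lambda>\<omega>. exp (- ((X \<omega> - s) / h)\<^sup>2 / 2)"
  have gi: "integrable M ?g"
    by (rule integrable_const_bound[of _ 1]) auto
  have "prob {\<omega> \<in> space M. \<bar>X \<omega> - s\<bar> \<le> h} = (\<integral>\<omega>. indicator {\<omega> \<in> space M. \<bar>X \<omega> - s\<bar> \<le> h} \<omega> \<partial>M)"
    by simp
  also have "\<dots> \<le> (\<integral>\<omega>. exp (1/2) * ?g \<omega> \<partial>M)"
  proof (rule integral_mono)
    fix \<omega> assume "\<omega> \<in> space M"
    show "indicator {\<omega> \<in> space M. \<bar>X \<omega> - s\<bar> \<le> h} \<omega> \<le> exp (1/2) * ?g \<omega>"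
    proof (cases "\<bar>X \<omega> - s\<bar> \<le> h")
      case True
      then have "\<bar>(X \<omega> - s) / h\<bar> \<le> 1" using h by (simp add: abs_divide)
      then have "((X \<omega> - s) / h)\<^sup>2 \<le> 1" by (simp add: abs_square_le_1)
      then show ?thesis by (auto simp: indicator_def simp flip: exp_add)
    qed (auto simp: indicator_def)
  qed (use gi in \<open>auto simp: integrable_indicator_iff emeasure_eq_measure\<close>)
  also have "\<dots> = exp (1/2) * (\<integral>\<omega>. ?g \<omega> \<partial>M)" by simp
  finally have 1: "prob {\<omega> \<in> space M. \<bar>X \<omega> - s\<bar> \<le> h} \<le> exp (1/2) * (\<integral>\<omega>. ?g \<omega> \<partial>M)" .
  \<comment> \<open>The Gaussian weight is the normal characteristic function at
    \<open>(X \<omega> - s) / h\<close>. After exchanging the integrals the centre \<open>s\<close>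
    survives only as a phase, so the bound is uniform in \<open>s\<close>.\<close>
  have "complex_of_real (\<integral>\<omega>. ?g \<omega> \<partial>M) = (\<integral>\<omega>. char ?N ((X \<omega> - s) / h) \<partial>M)"
    unfolding char_std_normal_distribution by (simp only: integral_complex_of_real)
  also have "\<dots> = (\<integral>\<omega>. (\<integral>z. iexp ((X \<omega> - s) / h * z) \<partial>?N) \<partial>M)"
    unfolding char_def ..
  also have "\<dots> = (\<integral>z. (\<integral>\<omega>. iexp ((X \<omega> - s) / h * z) \<partial>M) \<partial>?N)"
    by (intro P.Fubini_integral[symmetric])
       (auto intro!: P.P.integrable_const_bound[of _ 1] simp: split_beta norm_exp_i_times simp del: of_real_mult of_real_divide of_real_diff)
  also have "\<dots> = (\<integral>z. iexp (- s * z / h) * char (distr M borel X) (z / h) \<partial>?N)"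
  proof (intro Bochner_Integration.integral_cong refl)
    fix z
    have "(\<integral>\<omega>. iexp ((X \<omega> - s) / h * z) \<partial>M) = (\<integral>\<omega>. iexp (- s * z / h) * iexp (z / h * X \<omega>) \<partial>M)"
      by (intro Bochner_Integration.integral_cong refl) (simp add: exp_add[symmetric] field_simps diff_divide_distrib)
    then show "(\<integral>\<omega>. iexp ((X \<omega> - s) / h * z) \<partial>M) = iexp (- s * z / h) * char (distr M borel X) (z / h)"
      by (simp add: char_def integral_distr)
  qed
  finally have 2: "complex_of_real (\<integral>\<omega>. ?g \<omega> \<partial>M)
     = (\<integral>z. iexp (- s * z / h) * char (distr M borel X) (z / h) \<partial>?N)" .
  have Bi: "integrable lborel (\<lambda>z. B (z / h))"
    using lborel_integrable_real_affine_iff[of "1/h" B 0] B h by simp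
  have Bv: "(LBINT z. B (z / h)) = h * (LBINT t. B t)"
    using lborel_integral_real_affine[of "1/h" B 0] h by simp
  have B0: "B t \<ge> 0" for t using B(2)[of t] norm_ge_zero order_trans by blast
  have Bm[measurable]: "(\<lambda>z. B (z / h)) \<in> borel_measurable borel" using Bi by auto
  \<comment> \<open>Replacing the density by its peak leaves Lebesgue measure, and rescaling by
    \<open>h\<close> produces the factor \<open>h\<close> in front of the integral of
    \<open>B\<close>.\<close>
  have pd: "std_normal_density z \<le> 1 / sqrt (2 * pi)" for z
    unfolding std_normal_density_def by (simp add: field_simps)
  have "(\<integral>\<omega>. ?g \<omega> \<partial>M) = norm (complex_of_real (\<integral>\<omega>. ?g \<omega> \<partial>M))"
    by (subst norm_of_real) (simp add: Bochner_Integration.integral_nonneg)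
  also have "\<dots> \<le> (\<integral>z. norm (iexp (- s * z / h) * char (distr M borel X) (z / h)) \<partial>?N)"
    unfolding 2 by (rule integral_norm_bound)
  also have "\<dots> = (\<integral>z. norm (char (distr M borel X) (z / h)) \<partial>?N)"
    by (simp add: norm_mult del: of_real_mult of_real_divide of_real_minus)
  also have "\<dots> = (LBINT z. std_normal_density z * norm (char (distr M borel X) (z / h)))"
    by (subst integral_density) (auto simp: normal_density_nonneg)
  also have "\<dots> \<le> (LBINT z. 1 / sqrt (2 * pi) * B (z / h))"
  proof (rule Bochner_Integration.integral_mono)
    show "integrable lborel (\<lambda>z. 1 / sqrt (2 * pi) * B (z / h))" using Bi by simp
    then show "integrable lborel (\<lambda>z. std_normal_density z * norm (char (distr M borel X) (z / h)))"
      by (rule Bochner_Integration.integrable_bound)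
         (auto simp: abs_mult B0 intro!: mult_mono pd B(2) simp del: times_divide_eq_left )
    show "std_normal_density z * norm (char (distr M borel X) (z / h)) \<le> 1 / sqrt (2 * pi) * B (z / h)" for z
      by (intro mult_mono pd B(2)) auto
  qed
  also have "\<dots> = h * (LBINT t. B t) / sqrt (2 * pi)" by (simp add: Bv)
  finally have 3: "(\<integral>\<omega>. ?g \<omega> \<partial>M) \<le> h * (LBINT t. B t) / sqrt (2 * pi)" .
  have "exp (1/2::real) = sqrt (exp 1)"
    by (rule real_sqrt_unique[symmetric]) (simp_all add: power2_eq_square exp_add[symmetric])
  also have "\<dots> \<le> sqrt (2 * pi)" using exp_le pi_gt3 by (intro real_sqrt_le_mono) linarith
  finally have 4: "exp (1/2) / sqrt (2 * pi) \<le> 1" by (simp add: field_simps)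
  have 5: "0 \<le> h * (LBINT t. B t)" using h B0 by (simp add: Bochner_Integration.integral_nonneg)
  have "prob {\<omega> \<in> space M. \<bar>X \<omega> - s\<bar> \<le> h} \<le> exp (1/2) * (h * (LBINT t. B t) / sqrt (2 * pi))"
    using 1 mult_left_mono[OF 3, of "exp (1/2)"] by (meson exp_ge_zero order_trans)
  also have "\<dots> = (exp (1/2) / sqrt (2 * pi)) * (h * (LBINT t. B t))" by simp
  also have "\<dots> \<le> h * (LBINT t. B t)" using mult_right_mono[OF 4 5] by simp
  finally show ?thesis .
qed

text \<open>The squared modulus is a double integral; after the substitution \<open>y = x + w\<close> the integral
  over \<open>x\<close> is Gaussian and only the phase depends on \<open>b\<close>.\<close>

lemma norm_char_noncentral_square:
  fixes t b :: real
  shows "norm (LBINT x. std_normal_density x *\<^sub>R iexp (t * (x + b)\<^sup>2)) ^ 4 * (1 + 4 * t\<^sup>2) \<le> 1"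
proof -
  let ?p = std_normal_density
  \<comment> \<open>The integrand of \<open>\<Phi> * cnj \<Phi>\<close> in the variables
    \<open>x\<close> and \<open>w = y - x\<close>. Its modulus is a probability density, which
    justifies the exchange of integrals.\<close>
  define F where "F x w = (?p x * ?p (x + w)) *\<^sub>R (iexp (t * (x + b)\<^sup>2) * iexp (- (t * (x + w + b)\<^sup>2)))" for x w
  define \<Phi> where "\<Phi> = (LBINT x. ?p x *\<^sub>R iexp (t * (x + b)\<^sup>2))"
  have cnj_iexp: "cnj (iexp u) = iexp (- u)" for u by (simp add: exp_cnj)
  have nF: "norm (F x w) = ?p x * ?p (x + w)" for x w
    unfolding F_def by (simp add: norm_mult norm_exp_i_times abs_mult del: of_real_mult of_real_power of_real_add)
  have pw: "has_bochner_integral lborel (\<lambda>w. ?p (x + w)) 1" for x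
    using lborel_has_bochner_integral_real_affine_iff[of 1 ?p 1 x]
    by (simp add: has_bochner_integral_iff)
  have Fm[measurable]: "case_prod F \<in> borel_measurable (lborel \<Otimes>\<^sub>M lborel)"
    unfolding F_def by measurable
  have Fi: "integrable (lborel \<Otimes>\<^sub>M lborel) (case_prod F)"
  proof (rule lborel_pair.Fubini_integrable)
    show "integrable lborel (\<lambda>x. LBINT y. norm (case_prod F (x, y)))"
      using pw by (simp add: nF has_bochner_integral_iff)
    show "AE x in lborel. integrable lborel (\<lambda>y. case_prod F (x, y))"
    proof (rule AE_I2)
      fix x
      show "integrable lborel (\<lambda>y. case_prod F (x, y))"
      proof (subst integrable_norm_iff[symmetric])
        show "integrable lborel (\<lambda>y. norm (case_prod F (x, y)))"
          using pw[of x] by (simp add: nF has_bochner_integral_iff)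
      qed (simp add: F_def)
    qed
  qed simp
  have "\<Phi> * cnj \<Phi> = (LBINT x. LBINT w. F x w)"
  proof -
    have "(LBINT w. F x w) = ?p x *\<^sub>R iexp (t * (x + b)\<^sup>2) * cnj \<Phi>" for x
    proof -
      have "(LBINT w. F x w) = (LBINT w. ?p x *\<^sub>R iexp (t * (x + b)\<^sup>2) * (?p (x + w) *\<^sub>R cnj (iexp (t * (x + w + b)\<^sup>2))))"
        unfolding F_def cnj_iexp by (simp add: ac_simps del: of_real_power of_real_add of_real_minus of_real_mult)
      also have "\<dots> = ?p x *\<^sub>R iexp (t * (x + b)\<^sup>2) * (LBINT w. ?p (x + w) *\<^sub>R cnj (iexp (t * (x + w + b)\<^sup>2)))"
        by (rule integral_mult_right_zero)
      also have "(LBINT w. ?p (x + w) *\<^sub>R cnj (iexp (t * (x + w + b)\<^sup>2))) = (LBINT y. ?p y *\<^sub>R cnj (iexp (t * (y + b)\<^sup>2)))"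
        using lborel_integral_real_affine[of 1 "\<lambda>y. ?p y *\<^sub>R cnj (iexp (t * (y + b)\<^sup>2))" x] by simp
      also have "\<dots> = cnj \<Phi>"
        unfolding \<Phi>_def by (subst Bochner_Integration.integral_cnj[symmetric]) (simp only: complex_cnj_scaleR)
      finally show ?thesis .
    qed
    then have "(LBINT x. LBINT w. F x w) = (LBINT x. ?p x *\<^sub>R iexp (t * (x + b)\<^sup>2) * cnj \<Phi>)" by simp
    also have "\<dots> = \<Phi> * cnj \<Phi>"
      unfolding \<Phi>_def by (rule integral_mult_left_zero)
    finally show ?thesis ..
  qed
  also have "\<dots> = (LBINT w. LBINT x. F x w)"
    using lborel_pair.Fubini_integral[OF Fi] by simp
  finally have sq: "\<Phi> * cnj \<Phi> = (LBINT w. LBINT x. F x w)" .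
  \<comment> \<open>Chosen so that the modulus of the inner integral is a multiple of a normal
    density in \<open>w\<close>; integrating it then leaves only the prefactor.\<close>
  define \<sigma> where "\<sigma> = sqrt (2 / (1 + 4 * t\<^sup>2))"
  have pos: "1 + 4 * t\<^sup>2 > 0" by (simp add: add_pos_nonneg)
  have s0: "\<sigma> > 0" and s2: "\<sigma>\<^sup>2 = 2 / (1 + 4 * t\<^sup>2)"
    unfolding \<sigma>_def using pos by (auto simp: field_simps)
  have inner: "norm (LBINT x. F x w) = 1 / sqrt (1 + 4 * t\<^sup>2) * normal_density 0 \<sigma> w" for w
  proof -
    \<comment> \<open>Centring \<open>x\<close> at \<open>- w / 2\<close> separates \<open>v\<close>
      from \<open>w\<close> in the Gaussian exponent. In the difference of the two phases the
      quadratic terms cancel, so it is affine in \<open>v\<close> and the integral over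
      \<open>v\<close> is again a normal characteristic function; \<open>b\<close> sits in a factor
      of modulus 1.\<close>
    have e: "F (- w / 2 + v / sqrt 2) w = (exp (- (w\<^sup>2) / 4) / sqrt (2 * pi)) *\<^sub>R
        (iexp (- 2 * t * w * b) * (?p v *\<^sub>R iexp ((- sqrt 2 * t * w) * v)))" for v
    proof -
      let ?x = "- w / 2 + v / sqrt 2"
      have q: "?x\<^sup>2 + (?x + w)\<^sup>2 = v\<^sup>2 + w\<^sup>2 / 2"
        by (simp add: power2_eq_square algebra_simps)
      have "?p ?x * ?p (?x + w) = (1 / sqrt (2 * pi)) * (1 / sqrt (2 * pi)) * exp (- (?x\<^sup>2 + (?x + w)\<^sup>2) / 2)"
        unfolding std_normal_density_def add_divide_distrib minus_add_distrib exp_add by simp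
      also have "\<dots> = exp (- (w\<^sup>2) / 4) / sqrt (2 * pi) * ?p v"
        unfolding q std_normal_density_def by (simp add: exp_add[symmetric] field_simps exp_diff exp_minus)
      finally have d: "?p ?x * ?p (?x + w) = exp (- (w\<^sup>2) / 4) / sqrt (2 * pi) * ?p v" .
      have "(sqrt 2)\<^sup>2 = (2::real)" by simp
      then have ph: "t * (?x + b)\<^sup>2 - t * (?x + w + b)\<^sup>2 = (- 2 * t * w * b) + ((- sqrt 2 * t * w) * v)"
        by (simp add: field_simps power2_eq_square)
      have "iexp (t * (?x + b)\<^sup>2) * iexp (- (t * (?x + w + b)\<^sup>2)) = iexp (t * (?x + b)\<^sup>2 - t * (?x + w + b)\<^sup>2)"
        by (simp add: exp_add[symmetric] algebra_simps)
      also have "\<dots> = iexp (- 2 * t * w * b) * iexp ((- sqrt 2 * t * w) * v)"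
        unfolding ph by (simp add: exp_add[symmetric] algebra_simps)
      finally show ?thesis unfolding F_def d by (simp add: ac_simps)
    qed
    have "(LBINT x. F x w) = (1 / sqrt 2) *\<^sub>R (LBINT v. F (- w / 2 + v / sqrt 2) w)"
      using lborel_integral_real_affine[of "1 / sqrt 2" "\<lambda>x. F x w" "- w / 2"] by simp
    also have "(LBINT v. F (- w / 2 + v / sqrt 2) w) = (exp (- (w\<^sup>2) / 4) / sqrt (2 * pi)) *\<^sub>R
        (iexp (- 2 * t * w * b) * (LBINT v. ?p v *\<^sub>R iexp ((- sqrt 2 * t * w) * v)))"
      unfolding e by (simp only: integral_scaleR_right integral_mult_right_zero)
    also have "(LBINT v. ?p v *\<^sub>R iexp ((- sqrt 2 * t * w) * v)) = char std_normal_distribution (- sqrt 2 * t * w)"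
      unfolding char_def by (subst integral_density) auto
    also have "\<dots> = complex_of_real (exp (- (t\<^sup>2 * w\<^sup>2)))"
      unfolding char_std_normal_distribution by (simp add: power_mult_distrib)
    finally have "norm (LBINT x. F x w) = 1 / sqrt 2 * (exp (- (w\<^sup>2) / 4) / sqrt (2 * pi)) * exp (- (t\<^sup>2 * w\<^sup>2))"
      by (simp add: norm_mult norm_exp_i_times del: of_real_mult of_real_power of_real_add of_real_minus)
    also have "\<dots> = exp (- (w\<^sup>2 * ((1 + 4 * t\<^sup>2) / 4))) / (sqrt 2 * sqrt (2 * pi))"
      by (simp add: exp_add[symmetric] field_simps)
    also have "\<dots> = 1 / sqrt (1 + 4 * t\<^sup>2) * normal_density 0 \<sigma> w"
      unfolding normal_density_def s2 using pos
      by (simp add: real_sqrt_divide real_sqrt_mult field_simps)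
    finally show ?thesis .
  qed
  have "(norm \<Phi>)\<^sup>2 = norm (\<Phi> * cnj \<Phi>)" by (simp add: norm_mult power2_eq_square)
  also have "\<dots> \<le> (LBINT w. norm (LBINT x. F x w))" unfolding sq by (rule integral_norm_bound)
  also have "\<dots> = 1 / sqrt (1 + 4 * t\<^sup>2)"
    unfolding inner using s0 by simp
  finally have "((norm \<Phi>)\<^sup>2)\<^sup>2 \<le> (1 / sqrt (1 + 4 * t\<^sup>2))\<^sup>2" by (rule power_mono) simp
  also have "\<dots> = 1 / (1 + 4 * t\<^sup>2)" using pos by (simp add: power_divide)
  finally show ?thesis unfolding \<Phi>_def[symmetric] using pos by (simp add: field_simps power_mult[symmetric])
qed

text \<open>Factors outside \<open>J\<close> have modulus at most 1. Four factors inside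
  \<open>J\<close> together are bounded by \<open>1 / (1 + (2 * a * t)\<^sup>2)\<close>, and
  Bernoulli's inequality bounds the \<open>k\<close>-th power of this by
  \<open>1 / (1 + k * (2 * a * t)\<^sup>2)\<close>, with integral
  \<open>pi / (2 * a * sqrt k)\<close>. The gain \<open>sqrt k\<close> is the one expected from the
  standard deviation of \<open>4 * k\<close> independent summands.\<close>

lemma (in prob_space) noncentral_chi_square_anti_concentration:
  fixes \<xi> :: "'i \<Rightarrow> 'a \<Rightarrow> real" and w x :: "'i \<Rightarrow> real" and a \<tau> h s :: real and k :: nat
  assumes indep: "indep_vars (\<lambda>_. borel) \<xi> I" and fin: "finite I"
    and dist: "\<And>j. j \<in> I \<Longrightarrow> distributed M lborel (\<xi> j) (\<lambda>x. ennreal (std_normal_density x))"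
    and J: "J \<subseteq> I" "card J = 4 * k" and k: "k > 0" and a: "a > 0" and h: "h > 0" and \<tau>: "\<tau> \<noteq> 0"
    and w: "\<And>j. j \<in> J \<Longrightarrow> a \<le> w j * \<tau>\<^sup>2"
  shows "prob {\<omega> \<in> space M. \<bar>(\<Sum>j\<in>I. w j * (x j + \<tau> * \<xi> j \<omega>)\<^sup>2) - s\<bar> \<le> h} \<le> h * pi / (2 * a * sqrt k)"
proof -
  define X where "X j \<omega> = w j * (x j + \<tau> * \<xi> j \<omega>)\<^sup>2" for j \<omega>
  have \<xi>m: "random_variable borel (\<xi> j)" if "j \<in> I" for j
    using indep that by (auto simp: indep_vars_def)
  have Xm: "random_variable borel (X j)" if "j \<in> I" for j
    unfolding X_def using \<xi>m[OF that] by measurable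
  have Xind: "indep_vars (\<lambda>_. borel) X I"
  proof -
    have "X = (\<lambda>j \<omega>. (\<lambda>y. w j * (x j + \<tau> * y)\<^sup>2) (\<xi> j \<omega>))" by (simp add: X_def fun_eq_iff)
    moreover have "indep_vars (\<lambda>_. borel) (\<lambda>j \<omega>. (\<lambda>y. w j * (x j + \<tau> * y)\<^sup>2) (\<xi> j \<omega>)) I"
      by (rule indep_vars_compose2[OF indep]) auto
    ultimately show ?thesis by simp
  qed
  have XJ: "norm (char (distr M borel (X j)) t) ^ 4 * (1 + (2 * a * t)\<^sup>2) \<le> 1" if j: "j \<in> J" for j t
  proof -
    have jI: "j \<in> I" using j J by auto
    have eq: "distr M lborel (\<xi> j) = density lborel (\<lambda>x. ennreal (std_normal_density x))"
      using distributed_distr_eq_density[OF dist[OF jI]] .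
    let ?c = "w j * \<tau>\<^sup>2 * t"
    have xs: "t * (w j * (x j + \<tau> * y)\<^sup>2) = ?c * (y + x j / \<tau>)\<^sup>2" for y
      using \<tau> by (simp add: field_simps power2_eq_square)
    have "char (distr M borel (X j)) t = (\<integral>\<omega>. iexp (t * X j \<omega>) \<partial>M)"
      unfolding char_def using Xm[OF jI] by (subst integral_distr) auto
    also have "\<dots> = (\<integral>\<omega>. (\<lambda>y. iexp (?c * (y + x j / \<tau>)\<^sup>2)) (\<xi> j \<omega>) \<partial>M)"
      unfolding X_def xs ..
    also have "\<dots> = (\<integral>y. iexp (?c * (y + x j / \<tau>)\<^sup>2) \<partial>distr M lborel (\<xi> j))"
      using \<xi>m[OF jI] by (subst integral_distr) auto
    also have "\<dots> = (LBINT y. std_normal_density y *\<^sub>R iexp (?c * (y + x j / \<tau>)\<^sup>2))"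
      unfolding eq by (subst integral_density) auto
    finally have "norm (char (distr M borel (X j)) t) ^ 4 * (1 + 4 * ?c\<^sup>2) \<le> 1"
      using norm_char_noncentral_square[of ?c "x j / \<tau>"] by simp
    moreover have "(2 * a * t)\<^sup>2 \<le> 4 * ?c\<^sup>2"
    proof -
      have "a\<^sup>2 \<le> (w j * \<tau>\<^sup>2)\<^sup>2" using w[OF j] a by (intro power_mono) auto
      then have "4 * (a\<^sup>2 * t\<^sup>2) \<le> 4 * ((w j * \<tau>\<^sup>2)\<^sup>2 * t\<^sup>2)" by (intro mult_left_mono mult_right_mono) auto
      then show ?thesis by (simp add: power_mult_distrib)
    qed
    ultimately show ?thesis
      by (smt (verit) mult_left_mono zero_le_power norm_ge_zero)
  qed
  have cle1: "norm (char (distr M borel (X j)) t) \<le> 1" if "j \<in> I" for j t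
    using real_distribution.cmod_char_le_1[OF real_distribution_distr[OF Xm[OF that]]] .
  let ?S = "\<lambda>\<omega>. \<Sum>j\<in>I. X j \<omega>"
  let ?B = "\<lambda>t. 1 / (1 + (2 * a * sqrt k * t)\<^sup>2)"
  have bound: "norm (char (distr M borel ?S) t) \<le> ?B t" for t
  proof -
    let ?z = "1 + (2 * a * t)\<^sup>2"
    have z1: "?z \<ge> 1" by simp
    let ?P = "\<Prod>j\<in>J. norm (char (distr M borel (X j)) t)"
    have "norm (char (distr M borel ?S) t) = (\<Prod>j\<in>I. norm (char (distr M borel (X j)) t))"
      unfolding char_distr_sum[OF Xind] by (simp add: prod_norm)
    also have "\<dots> \<le> ?P"
    proof -
      have "(\<Prod>j\<in>I. norm (char (distr M borel (X j)) t)) = (\<Prod>j\<in>I - J. norm (char (distr M borel (X j)) t)) * ?P"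
        using J(1) fin by (intro prod.subset_diff) auto
      also have "\<dots> \<le> 1 * ?P"
        using cle1 by (intro mult_right_mono prod_le_1 prod_nonneg) auto
      finally show ?thesis by simp
    qed
    finally have 1: "norm (char (distr M borel ?S) t) \<le> ?P" .
    have "?P ^ 4 = (\<Prod>j\<in>J. norm (char (distr M borel (X j)) t) ^ 4)" by (simp add: prod_power_distrib)
    also have "\<dots> \<le> (\<Prod>j\<in>J. 1 / ?z)"
    proof (intro prod_mono conjI)
      have "?z > 0" using z1 by linarith
      then show "norm (char (distr M borel (X j)) t) ^ 4 \<le> 1 / ?z" if "j \<in> J" for j
        using XJ[OF that, of t] by (subst pos_le_divide_eq)
    qed auto
    also have "\<dots> = ((1 / ?z) ^ k) ^ 4" by (simp add: J(2) power_mult[symmetric] mult.commute)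
    finally have "?P \<le> (1 / ?z) ^ k"
      by (rule power_le_imp_le_base[of _ 3, simplified]) (use z1 in auto)
    also have "\<dots> = 1 / ?z ^ k" by (simp add: power_divide)
    also have "\<dots> \<le> 1 / (1 + real k * (2 * a * t)\<^sup>2)"
    proof (rule divide_left_mono)
      have "- 1 \<le> (2 * a * t)\<^sup>2" by (rule order_trans[of _ 0]) auto
      from Bernoulli_inequality[OF this, of k] show "1 + real k * (2 * a * t)\<^sup>2 \<le> ?z ^ k" by simp
      show "0 < ?z ^ k * (1 + real k * (2 * a * t)\<^sup>2)"
        by (intro mult_pos_pos zero_less_power add_pos_nonneg) auto
    qed simp
    also have "\<dots> = ?B t" by (simp add: power_mult_distrib)
    finally show ?thesis using 1 by linarith
  qed
  have a': "0 < 2 * a * sqrt k" using a k by simp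
  have "prob {\<omega> \<in> space M. \<bar>?S \<omega> - s\<bar> \<le> h} \<le> h * (LBINT t. ?B t)"
    using Xm lborel_integral_inverse_one_plus_square(1)[OF a'] bound
    by (intro concentration_le_integral_char h) auto
  then show ?thesis
    unfolding lborel_integral_inverse_one_plus_square(2)[OF a'] X_def by simp
qed

section \<open>Comparison of noncentral sums with different shifts\<close>

lemma (in prob_space) iid_std_normal_sum_tail:
  fixes \<xi> :: "'i \<Rightarrow> 'a \<Rightarrow> real" and c :: "'i \<Rightarrow> real"
  assumes indep: "indep_vars (\<lambda>_. borel) \<xi> I" and fin: "finite I"
    and dist: "\<And>j. j \<in> I \<Longrightarrow> distributed M lborel (\<xi> j) (\<lambda>x. ennreal (std_normal_density x))"
    and h: "h > 0"
  shows "prob {\<omega> \<in> space M. h \<le> \<bar>\<Sum>j\<in>I. c j * \<xi> j \<omega>\<bar>} \<le> (\<Sum>j\<in>I. (c j)\<^sup>2) / h\<^sup>2"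
proof -
  have \<xi>m: "random_variable borel (\<xi> j)" if "j \<in> I" for j
    using indep that by (auto simp: indep_vars_def)
  have int1: "integrable M (\<xi> j)" if "j \<in> I" for j
    using distributed_integrable[OF dist[OF that], of "\<lambda>x. x"] integrable_std_normal_moment[of 1] by simp
  have ex1: "expectation (\<xi> j) = 0" if "j \<in> I" for j
    using standard_normal_distributed_expectation[OF dist[OF that]] .
  have int2: "integrable M (\<lambda>\<omega>. \<xi> j \<omega> * \<xi> j \<omega>)" if "j \<in> I" for j
    using distributed_integrable[OF dist[OF that], of "\<lambda>x. x * x"] integrable_std_normal_moment[of 2]
    by (simp add: power2_eq_square)
  have ex2: "expectation (\<lambda>\<omega>. \<xi> j \<omega> * \<xi> j \<omega>) = 1" if "j \<in> I" for j
    using standard_normal_distributed_variance[OF dist[OF that]] ex1[OF that] by (simp add: power2_eq_square)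
  have mixed: "integrable M (\<lambda>\<omega>. \<xi> i \<omega> * \<xi> j \<omega>) \<and> expectation (\<lambda>\<omega>. \<xi> i \<omega> * \<xi> j \<omega>) = (if i = j then 1 else 0)"
    if "i \<in> I" "j \<in> I" for i j
  proof (cases "i = j")
    case False
    have ind: "indep_vars (\<lambda>_. borel) \<xi> {i, j}"
      using indep_vars_subset[OF indep, of "{i, j}"] that by auto
    have *: "\<And>k. k \<in> {i, j} \<Longrightarrow> integrable M (\<xi> k)" using int1 that by auto
    from indep_vars_integrable[OF _ ind *] indep_vars_lebesgue_integral[OF _ ind *] False ex1[OF that(1)]
    show ?thesis by simp
  qed (use that int2 ex2 in simp)
  have sq: "(\<Sum>j\<in>I. c j * \<xi> j \<omega>)\<^sup>2 = (\<Sum>i\<in>I. \<Sum>j\<in>I. (c i * c j) * (\<xi> i \<omega> * \<xi> j \<omega>))" for \<omega>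
    by (simp add: power2_eq_square sum_product ac_simps)
  have int: "integrable M (\<lambda>\<omega>. (\<Sum>j\<in>I. c j * \<xi> j \<omega>)\<^sup>2)"
    unfolding sq using mixed by (intro Bochner_Integration.integrable_sum integrable_mult_right) auto
  have "expectation (\<lambda>\<omega>. (\<Sum>j\<in>I. c j * \<xi> j \<omega>)\<^sup>2) = (\<Sum>i\<in>I. \<Sum>j\<in>I. (c i * c j) * (if i = j then 1 else 0))"
    unfolding sq using mixed by (simp add: Bochner_Integration.integral_sum)
  also have "\<dots> = (\<Sum>i\<in>I. (c i)\<^sup>2)"
    using fin by (simp add: power2_eq_square if_distrib cong: if_cong)
  finally have ex: "expectation (\<lambda>\<omega>. (\<Sum>j\<in>I. c j * \<xi> j \<omega>)\<^sup>2) = (\<Sum>i\<in>I. (c i)\<^sup>2)" .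
  have "random_variable borel (\<lambda>\<omega>. \<Sum>j\<in>I. c j * \<xi> j \<omega>)"
    using \<xi>m by (intro borel_measurable_sum borel_measurable_times) auto
  from second_moment_method[OF this int h] show ?thesis by (simp add: ex)
qed

text \<open>In the difference of the two sums the squares of the noise cancel. There remain a
  deterministic part, at most \<open>b * R \<le> h / 2\<close>, and a Gaussian linear part of
  variance at most \<open>4 * \<tau>\<^sup>2 * b\<^sup>2 * R\<close>. Unless the linear part reaches
  \<open>h / 2\<close>, the events can differ only where the sum for \<open>y\<close> lies within
  \<open>h\<close> of \<open>u\<close>. The common envelope \<open>\<theta>\<close> lets the same
  bound serve both for two nearby signals and for a signal compared with 0.\<close>

lemma (in prob_space) noncentral_chi_square_shift:
  fixes \<xi> :: "'i \<Rightarrow> 'a \<Rightarrow> real" and w x y \<theta> :: "'i \<Rightarrow> real" and a b R \<tau> h u :: real and k :: nat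
  assumes indep: "indep_vars (\<lambda>_. borel) \<xi> I" and fin: "finite I"
    and dist: "\<And>j. j \<in> I \<Longrightarrow> distributed M lborel (\<xi> j) (\<lambda>x. ennreal (std_normal_density x))"
    and J: "J \<subseteq> I" "card J = 4 * k" and k: "k > 0" and a: "a > 0" and h: "h > 0" and \<tau>: "\<tau> \<noteq> 0"
    and wJ: "\<And>j. j \<in> J \<Longrightarrow> a \<le> w j * \<tau>\<^sup>2"
    and w: "\<And>j. j \<in> I \<Longrightarrow> 0 \<le> w j"
    and xy: "\<And>j. j \<in> I \<Longrightarrow> x j = y j \<or> w j \<le> b"
    and \<theta>: "\<And>j. j \<in> I \<Longrightarrow> \<bar>x j\<bar> \<le> \<bar>\<theta> j\<bar> \<and> \<bar>y j\<bar> \<le> \<bar>\<theta> j\<bar> \<and> \<bar>x j - y j\<bar> \<le> \<bar>\<theta> j\<bar>"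
    and R: "(\<Sum>j\<in>I. (\<theta> j)\<^sup>2) \<le> R" and b: "b \<ge> 0" and bR: "b * R \<le> h / 2"
  shows "\<bar>prob {\<omega> \<in> space M. (\<Sum>j\<in>I. w j * (x j + \<tau> * \<xi> j \<omega>)\<^sup>2) \<le> u}
          - prob {\<omega> \<in> space M. (\<Sum>j\<in>I. w j * (y j + \<tau> * \<xi> j \<omega>)\<^sup>2) \<le> u}\<bar>
         \<le> h * pi / (2 * a * sqrt k) + 16 * \<tau>\<^sup>2 * b\<^sup>2 * R / h\<^sup>2"
proof -
  define S where "S z \<omega> = (\<Sum>j\<in>I. w j * (z j + \<tau> * \<xi> j \<omega>)\<^sup>2)" for z :: "'i \<Rightarrow> real" and \<omega>
  define c where "c j = 2 * \<tau> * w j * (x j - y j)" for j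
  define L where "L \<omega> = (\<Sum>j\<in>I. c j * \<xi> j \<omega>)" for \<omega>
  have \<xi>m: "random_variable borel (\<xi> j)" if "j \<in> I" for j
    using indep that by (auto simp: indep_vars_def)
  have Sm[measurable]: "random_variable borel (S z)" for z
    unfolding S_def using \<xi>m
    by (intro borel_measurable_sum borel_measurable_times borel_measurable_power borel_measurable_add) auto
  have Lm[measurable]: "random_variable borel L"
    unfolding L_def using \<xi>m by (intro borel_measurable_sum borel_measurable_times) auto
  have wd: "w j * \<bar>x j - y j\<bar> \<le> b * \<bar>\<theta> j\<bar>" if "j \<in> I" for j
  proof (cases "x j = y j")
    case False
    with xy[OF that] have "w j \<le> b" by simp
    then show ?thesis using \<theta>[OF that] b by (intro mult_mono) auto
  qed (use b in simp)
  have det: "\<bar>\<Sum>j\<in>I. w j * ((x j)\<^sup>2 - (y j)\<^sup>2)\<bar> \<le> h / 2"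
  proof -
    have "\<bar>\<Sum>j\<in>I. w j * ((x j)\<^sup>2 - (y j)\<^sup>2)\<bar> \<le> (\<Sum>j\<in>I. \<bar>w j * ((x j)\<^sup>2 - (y j)\<^sup>2)\<bar>)" by (rule sum_abs)
    also have "\<dots> \<le> (\<Sum>j\<in>I. b * (\<theta> j)\<^sup>2)"
    proof (rule sum_mono)
      fix j assume j: "j \<in> I"
      show "\<bar>w j * ((x j)\<^sup>2 - (y j)\<^sup>2)\<bar> \<le> b * (\<theta> j)\<^sup>2"
      proof (cases "x j = y j")
        case False
        with xy[OF j] have wb: "w j \<le> b" by simp
        have "(x j)\<^sup>2 \<le> (\<theta> j)\<^sup>2" "(y j)\<^sup>2 \<le> (\<theta> j)\<^sup>2" using \<theta>[OF j] by (auto simp: abs_le_square_iff)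
        then have "\<bar>(x j)\<^sup>2 - (y j)\<^sup>2\<bar> \<le> (\<theta> j)\<^sup>2" using zero_le_power2[of "x j"] zero_le_power2[of "y j"] by linarith
        then show ?thesis using w[OF j] wb b by (auto simp: abs_mult intro!: mult_mono)
      qed (use b in simp)
    qed
    also have "\<dots> \<le> b * R" using R b by (simp add: sum_distrib_left[symmetric] mult_left_mono)
    finally show ?thesis using bR by linarith
  qed
  have diff: "S x \<omega> - S y \<omega> = (\<Sum>j\<in>I. w j * ((x j)\<^sup>2 - (y j)\<^sup>2)) + L \<omega>" for \<omega>
    unfolding S_def L_def c_def
    by (simp add: sum_subtractf[symmetric] sum.distrib[symmetric] power2_eq_square algebra_simps)
  have cs: "(\<Sum>j\<in>I. (c j)\<^sup>2) \<le> 4 * \<tau>\<^sup>2 * b\<^sup>2 * R"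
  proof -
    have "(\<Sum>j\<in>I. (c j)\<^sup>2) \<le> (\<Sum>j\<in>I. 4 * \<tau>\<^sup>2 * b\<^sup>2 * (\<theta> j)\<^sup>2)"
    proof (rule sum_mono)
      fix j assume j: "j \<in> I"
      have "(w j * \<bar>x j - y j\<bar>)\<^sup>2 \<le> (b * \<bar>\<theta> j\<bar>)\<^sup>2" using wd[OF j] w[OF j] by (intro power_mono) auto
      then have "4 * \<tau>\<^sup>2 * (w j * \<bar>x j - y j\<bar>)\<^sup>2 \<le> 4 * \<tau>\<^sup>2 * (b * \<bar>\<theta> j\<bar>)\<^sup>2" by (intro mult_left_mono) auto
      then show "(c j)\<^sup>2 \<le> 4 * \<tau>\<^sup>2 * b\<^sup>2 * (\<theta> j)\<^sup>2"
        by (simp add: c_def power_mult_distrib mult.assoc)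
    qed
    also have "\<dots> \<le> 4 * \<tau>\<^sup>2 * b\<^sup>2 * R" using R by (simp add: sum_distrib_left[symmetric] mult_left_mono)
    finally show ?thesis .
  qed
  let ?q = "prob {\<omega> \<in> space M. h / 2 \<le> \<bar>L \<omega>\<bar>}"
  let ?v = "prob {\<omega> \<in> space M. \<bar>S y \<omega> - u\<bar> \<le> h}"
  have "?q \<le> (\<Sum>j\<in>I. (c j)\<^sup>2) / (h / 2)\<^sup>2"
    unfolding L_def using iid_std_normal_sum_tail[OF indep fin dist, of "h / 2" c] h by simp
  also have "\<dots> \<le> 4 * \<tau>\<^sup>2 * b\<^sup>2 * R / (h / 2)\<^sup>2" using cs by (intro divide_right_mono) auto
  also have "\<dots> = 16 * \<tau>\<^sup>2 * b\<^sup>2 * R / h\<^sup>2" by (simp add: power_divide)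
  finally have q: "?q \<le> 16 * \<tau>\<^sup>2 * b\<^sup>2 * R / h\<^sup>2" .
  have v: "?v \<le> h * pi / (2 * a * sqrt k)"
    unfolding S_def by (rule noncentral_chi_square_anti_concentration[OF indep fin dist J k a h \<tau> wJ])
  have "prob {\<omega> \<in> space M. S x \<omega> \<le> u} \<le> prob ({\<omega> \<in> space M. S y \<omega> \<le> u} \<union> {\<omega> \<in> space M. \<bar>S y \<omega> - u\<bar> \<le> h} \<union> {\<omega> \<in> space M. h / 2 \<le> \<bar>L \<omega>\<bar>})"
  proof (rule finite_measure_mono)
    show "{\<omega> \<in> space M. S x \<omega> \<le> u} \<subseteq> {\<omega> \<in> space M. S y \<omega> \<le> u} \<union> {\<omega> \<in> space M. \<bar>S y \<omega> - u\<bar> \<le> h} \<union> {\<omega> \<in> space M. h / 2 \<le> \<bar>L \<omega>\<bar>}"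
      using det diff by (auto simp: not_le) (smt (verit) field_sum_of_halves)
  qed measurable
  also have "\<dots> \<le> prob {\<omega> \<in> space M. S y \<omega> \<le> u} + ?v + ?q"
    by (intro order_trans[OF measure_Un_le] add_mono order_refl measure_Un_le) measurable
  finally have 1: "prob {\<omega> \<in> space M. S x \<omega> \<le> u} \<le> prob {\<omega> \<in> space M. S y \<omega> \<le> u} + ?v + ?q" .
  have "prob {\<omega> \<in> space M. S y \<omega> \<le> u} \<le> prob ({\<omega> \<in> space M. S x \<omega> \<le> u} \<union> {\<omega> \<in> space M. \<bar>S y \<omega> - u\<bar> \<le> h} \<union> {\<omega> \<in> space M. h / 2 \<le> \<bar>L \<omega>\<bar>})"
  proof (rule finite_measure_mono)
    show "{\<omega> \<in> space M. S y \<omega> \<le> u} \<subseteq> {\<omega> \<in> space M. S x \<omega> \<le> u} \<union> {\<omega> \<in> space M. \<bar>S y \<omega> - u\<bar> \<le> h} \<union> {\<omega> \<in> space M. h / 2 \<le> \<bar>L \<omega>\<bar>}"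
      using det diff by (auto simp: not_le) (smt (verit) field_sum_of_halves)
  qed measurable
  also have "\<dots> \<le> prob {\<omega> \<in> space M. S x \<omega> \<le> u} + ?v + ?q"
    by (intro order_trans[OF measure_Un_le] add_mono order_refl measure_Un_le) measurable
  finally have 2: "prob {\<omega> \<in> space M. S y \<omega> \<le> u} \<le> prob {\<omega> \<in> space M. S x \<omega> \<le> u} + ?v + ?q" .
  show ?thesis using 1 2 q v unfolding S_def[symmetric] by linarith
qed

subsection \<open>Infinite sums\<close>

text \<open>The first identity holds without summability: a divergent \<open>infsum\<close> is 0 and
  so is \<open>enn2real top\<close>. Random series are therefore measurable before anything is known
  about where they converge.\<close>

lemma infsum_nonneg_eq_enn2real_suminf:
  fixes f :: "nat \<Rightarrow> real"
  assumes nn: "\<And>j. j \<ge> 1 \<Longrightarrow> f j \<ge> 0"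
  shows "infsum f {1..} = enn2real (\<Sum>j. ennreal (f (Suc j)))"
    and "f summable_on {1..} \<longleftrightarrow> (\<Sum>j. ennreal (f (Suc j))) \<noteq> top"
proof -
  have nn': "f (Suc j) \<ge> 0" for j using nn by simp
  have im: "{1..} = range Suc" by (auto simp: image_iff) (metis Suc_le_D)
  have so: "f summable_on {1..} \<longleftrightarrow> summable (\<lambda>j. f (Suc j))"
    unfolding im by (subst summable_on_reindex) (auto simp: o_def summable_on_UNIV_nonneg_real_iff nn')
  show *: "f summable_on {1..} \<longleftrightarrow> (\<Sum>j. ennreal (f (Suc j))) \<noteq> top"
    unfolding so
  proof
    show "summable (\<lambda>j. f (Suc j))" if "(\<Sum>j. ennreal (f (Suc j))) \<noteq> top"
      by (rule summable_suminf_not_top[OF nn' that])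
    show "(\<Sum>j. ennreal (f (Suc j))) \<noteq> top" if "summable (\<lambda>j. f (Suc j))"
      by (rule ennreal_suminf_neq_top[OF that nn'])
  qed
  show "infsum f {1..} = enn2real (\<Sum>j. ennreal (f (Suc j)))"
  proof (cases "summable (\<lambda>j. f (Suc j))")
    case True
    then have "(\<lambda>j. f (Suc j)) summable_on UNIV" using nn' by (simp add: summable_on_UNIV_nonneg_real_iff)
    then have "infsum (\<lambda>j. f (Suc j)) UNIV = (\<Sum>j. f (Suc j))"
      by (metis has_sum_imp_sums has_sum_infsum sums_unique)
    moreover have "infsum f {1..} = infsum (\<lambda>j. f (Suc j)) UNIV"
      unfolding im by (subst infsum_reindex) (auto simp: o_def)
    ultimately show ?thesis
      using True nn' by (subst suminf_ennreal2) (auto simp: suminf_nonneg)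
  next
    case False
    then show ?thesis using so * by (auto simp: infsum_not_exists)
  qed
qed

lemma borel_measurable_infsum_nonneg:
  fixes g :: "nat \<Rightarrow> 'a \<Rightarrow> real"
  assumes "\<And>j. j \<ge> 1 \<Longrightarrow> g j \<in> borel_measurable M" "\<And>j \<omega>. j \<ge> 1 \<Longrightarrow> g j \<omega> \<ge> 0"
  shows "(\<lambda>\<omega>. \<Sum>\<^sub>\<infinity>j\<in>{1..}. g j \<omega>) \<in> borel_measurable M"
proof -
  have "(\<lambda>\<omega>. \<Sum>\<^sub>\<infinity>j\<in>{1..}. g j \<omega>) = (\<lambda>\<omega>. enn2real (\<Sum>j. ennreal (g (Suc j) \<omega>)))"
    using assms(2) by (intro ext infsum_nonneg_eq_enn2real_suminf) auto
  also have "\<dots> \<in> borel_measurable M" using assms(1) by measurable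
  finally show ?thesis .
qed

lemma infsum_nonneg_le_iff:
  fixes f :: "nat \<Rightarrow> real"
  assumes nn: "\<And>j. j \<ge> 1 \<Longrightarrow> f j \<ge> 0" and f: "f summable_on {1..}"
  shows "infsum f {1..} \<le> v \<longleftrightarrow> (\<forall>N. (\<Sum>j=1..N. f j) \<le> v)"
proof (intro iffI allI)
  fix N assume "infsum f {1..} \<le> v"
  moreover have "(\<Sum>j=1..N. f j) \<le> infsum f {1..}"
    using nn by (intro finite_sum_le_infsum f) auto
  ultimately show "(\<Sum>j=1..N. f j) \<le> v" by linarith
next
  assume v: "\<forall>N. (\<Sum>j=1..N. f j) \<le> v"
  show "infsum f {1..} \<le> v"
  proof (rule infsum_le_finite_sums[OF f])
    fix F :: "nat set" assume F: "finite F" "F \<subseteq> {1..}"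
    then have "sum f F \<le> (\<Sum>j=1..Max (insert 0 F). f j)"
      using nn by (intro sum_mono2) auto
    then show "sum f F \<le> v" using v order_trans by blast
  qed
qed

text \<open>The events for the partial sums decrease, and where the series converges their
  intersection is the event for the full sum. Where it diverges the default value 0 would falsify
  this, hence the almost sure summability. Because the inequality is weak, the limit is right for
  every \<open>v\<close>, atoms included.\<close>

lemma (in prob_space) prob_infsum_le_LIMSEQ:
  fixes g :: "nat \<Rightarrow> 'a \<Rightarrow> real"
  assumes g: "\<And>j. j \<ge> 1 \<Longrightarrow> random_variable borel (g j)" "\<And>j \<omega>. j \<ge> 1 \<Longrightarrow> g j \<omega> \<ge> 0"
    and ae: "AE \<omega> in M. (\<lambda>j. g j \<omega>) summable_on {1..}"
  shows "(\<lambda>N. prob {\<omega> \<in> space M. (\<Sum>j=1..N. g j \<omega>) \<le> v})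
           \<longlonglongrightarrow> prob {\<omega> \<in> space M. (\<Sum>\<^sub>\<infinity>j\<in>{1..}. g j \<omega>) \<le> v}"
proof -
  define E where "E N = {\<omega> \<in> space M. (\<Sum>j=1..N. g j \<omega>) \<le> v}" for N
  have sm: "random_variable borel (\<lambda>\<omega>. \<Sum>j=1..N. g j \<omega>)" for N
    using g(1) by (intro borel_measurable_sum) auto
  have E: "E N \<in> events" for N unfolding E_def using sm[of N] by measurable
  have "decseq E"
  proof (rule decseq_SucI)
    fix N show "E (Suc N) \<subseteq> E N"
      unfolding E_def using g(2)[of "Suc N"] by auto (smt (verit))
  qed
  then have "(\<lambda>N. prob (E N)) \<longlonglongrightarrow> prob (\<Inter>N. E N)"
    using E by (intro finite_Lim_measure_decseq) auto
  also have "prob (\<Inter>N. E N) = prob {\<omega> \<in> space M. (\<Sum>\<^sub>\<infinity>j\<in>{1..}. g j \<omega>) \<le> v}"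
  proof (rule measure_eq_AE)
    show "AE \<omega> in M. \<omega> \<in> (\<Inter>N. E N) \<longleftrightarrow> \<omega> \<in> {\<omega> \<in> space M. (\<Sum>\<^sub>\<infinity>j\<in>{1..}. g j \<omega>) \<le> v}"
      using ae
    proof (eventually_elim)
      fix \<omega> assume s: "(\<lambda>j. g j \<omega>) summable_on {1..}"
      show "\<omega> \<in> (\<Inter>N. E N) \<longleftrightarrow> \<omega> \<in> {\<omega> \<in> space M. (\<Sum>\<^sub>\<infinity>j\<in>{1..}. g j \<omega>) \<le> v}"
        using infsum_nonneg_le_iff[OF g(2) s, of v] by (auto simp: E_def)
    qed
    show "(\<Inter>N. E N) \<in> events" using E by auto
    show "{\<omega> \<in> space M. (\<Sum>\<^sub>\<infinity>j\<in>{1..}. g j \<omega>) \<le> v} \<in> events"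
      using borel_measurable_infsum_nonneg[OF g] by measurable
  qed
  finally show ?thesis unfolding E_def .
qed

text \<open>Each term has mean at most \<open>(2 * B + 2 * \<tau>\<^sup>2) * w j\<close>, so the
  series has finite expectation and is finite almost surely.\<close>

lemma (in prob_space) AE_noncentral_chi_square_summable:
  fixes \<xi> :: "nat \<Rightarrow> 'a \<Rightarrow> real" and w x :: "nat \<Rightarrow> real" and \<tau> B :: real
  assumes \<xi>m: "\<And>j. j \<ge> 1 \<Longrightarrow> random_variable borel (\<xi> j)"
    and dist: "\<And>j. j \<ge> 1 \<Longrightarrow> distributed M lborel (\<xi> j) (\<lambda>x. ennreal (std_normal_density x))"
    and w: "\<And>j. j \<ge> 1 \<Longrightarrow> 0 \<le> w j" "w summable_on {1..}"
    and x: "\<And>j. j \<ge> 1 \<Longrightarrow> (x j)\<^sup>2 \<le> B"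
  shows "AE \<omega> in M. (\<lambda>j. w j * (x j + \<tau> * \<xi> j \<omega>)\<^sup>2) summable_on {1..}"
proof -
  define g where "g j \<omega> = ennreal (w (Suc j) * (x (Suc j) + \<tau> * \<xi> (Suc j) \<omega>)\<^sup>2)" for j \<omega>
  have gm[measurable]: "g j \<in> borel_measurable M" for j
    unfolding g_def using \<xi>m[of "Suc j"] by measurable
  have gi: "(\<integral>\<^sup>+\<omega>. g j \<omega> \<partial>M) \<le> ennreal ((2 * B + 2 * \<tau>\<^sup>2) * w (Suc j))" for j
  proof -
    let ?\<xi> = "\<xi> (Suc j)"
    have D: "distributed M lborel ?\<xi> (\<lambda>x. ennreal (std_normal_density x))" using dist by simp
    have i1: "integrable M ?\<xi>"
      using distributed_integrable[OF D, of "\<lambda>x. x"] integrable_std_normal_moment[of 1] by simp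
    have i2: "integrable M (\<lambda>\<omega>. (?\<xi> \<omega>)\<^sup>2)"
      using distributed_integrable[OF D, of "\<lambda>x. x\<^sup>2"] integrable_std_normal_moment[of 2] by simp
    have e2: "expectation (\<lambda>\<omega>. (?\<xi> \<omega>)\<^sup>2) = 1"
      using standard_normal_distributed_variance[OF D] standard_normal_distributed_expectation[OF D] by simp
    have "g j \<omega> \<le> ennreal (w (Suc j) * (2 * B + 2 * \<tau>\<^sup>2 * (?\<xi> \<omega>)\<^sup>2))" for \<omega>
    proof -
      have "(x (Suc j) + \<tau> * ?\<xi> \<omega>)\<^sup>2 \<le> 2 * (x (Suc j))\<^sup>2 + 2 * (\<tau> * ?\<xi> \<omega>)\<^sup>2"
        using sum_squares_bound[of "x (Suc j)" "\<tau> * ?\<xi> \<omega>"] by (simp add: power2_sum)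
      also have "\<dots> \<le> 2 * B + 2 * \<tau>\<^sup>2 * (?\<xi> \<omega>)\<^sup>2" using x[of "Suc j"] by (simp add: power_mult_distrib)
      finally show ?thesis
        unfolding g_def using w(1)[of "Suc j"] by (intro ennreal_leI mult_left_mono) auto
    qed
    then have "(\<integral>\<^sup>+\<omega>. g j \<omega> \<partial>M) \<le> (\<integral>\<^sup>+\<omega>. ennreal (w (Suc j) * (2 * B + 2 * \<tau>\<^sup>2 * (?\<xi> \<omega>)\<^sup>2)) \<partial>M)"
      by (intro nn_integral_mono)
    also have "\<dots> = ennreal (expectation (\<lambda>\<omega>. w (Suc j) * (2 * B + 2 * \<tau>\<^sup>2 * (?\<xi> \<omega>)\<^sup>2)))"
    proof (rule nn_integral_eq_integral)
      show "integrable M (\<lambda>\<omega>. w (Suc j) * (2 * B + 2 * \<tau>\<^sup>2 * (?\<xi> \<omega>)\<^sup>2))" using i2 by simp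
      have "B \<ge> 0" using x[of 1] zero_le_power2[of "x 1"] by linarith
      then show "AE \<omega> in M. 0 \<le> w (Suc j) * (2 * B + 2 * \<tau>\<^sup>2 * (?\<xi> \<omega>)\<^sup>2)" using w(1)[of "Suc j"] by simp
    qed
    also have "expectation (\<lambda>\<omega>. w (Suc j) * (2 * B + 2 * \<tau>\<^sup>2 * (?\<xi> \<omega>)\<^sup>2)) = w (Suc j) * (2 * B + 2 * \<tau>\<^sup>2)"
      using i2 e2 by (simp add: prob_space)
    finally show ?thesis by (simp add: mult.commute)
  qed
  have B0: "B \<ge> 0" using x[of 1] zero_le_power2[of "x 1"] by linarith
  have "(\<lambda>j. (2 * B + 2 * \<tau>\<^sup>2) * w j) summable_on {1..}"
    by (rule summable_on_cmult_right[OF w(2)])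
  then have fin: "(\<Sum>j. ennreal ((2 * B + 2 * \<tau>\<^sup>2) * w (Suc j))) \<noteq> top"
    by (subst infsum_nonneg_eq_enn2real_suminf(2)[symmetric]) (use w(1) B0 in auto)
  have "(\<integral>\<^sup>+\<omega>. (\<Sum>j. g j \<omega>) \<partial>M) = (\<Sum>j. \<integral>\<^sup>+\<omega>. g j \<omega> \<partial>M)"
    by (rule nn_integral_suminf) simp
  also have "\<dots> \<le> (\<Sum>j. ennreal ((2 * B + 2 * \<tau>\<^sup>2) * w (Suc j)))"
    using gi by (intro suminf_le) auto
  finally have "(\<integral>\<^sup>+\<omega>. (\<Sum>j. g j \<omega>) \<partial>M) \<noteq> \<infinity>" using fin by (auto simp: top_unique)
  then have "AE \<omega> in M. (\<Sum>j. g j \<omega>) \<noteq> \<infinity>" by (intro nn_integral_PInf_AE) auto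
  then show ?thesis
  proof eventually_elim
    case (elim \<omega>)
    then show ?case using w(1) by (subst infsum_nonneg_eq_enn2real_suminf(2)) (auto simp: g_def)
  qed
qed

text \<open>The finite bound does not depend on the truncation, so it passes to the limit;
  truncations from \<open>4 * k\<close> on contain the coordinates that spread the sum.\<close>

lemma (in prob_space) noncentral_chi_square_shift_infsum:
  fixes \<xi> :: "nat \<Rightarrow> 'a \<Rightarrow> real" and w x y \<theta> :: "nat \<Rightarrow> real" and a b R \<tau> h v :: real and k :: nat
  assumes indep: "indep_vars (\<lambda>_. borel) \<xi> {1..}"
    and dist: "\<And>j. j \<ge> 1 \<Longrightarrow> distributed M lborel (\<xi> j) (\<lambda>x. ennreal (std_normal_density x))"
    and k: "k > 0" and a: "a > 0" and h: "h > 0" and \<tau>: "\<tau> \<noteq> 0"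
    and wk: "\<And>j. 1 \<le> j \<Longrightarrow> j \<le> 4 * k \<Longrightarrow> a \<le> w j * \<tau>\<^sup>2"
    and w: "\<And>j. j \<ge> 1 \<Longrightarrow> 0 \<le> w j" "w summable_on {1..}"
    and xy: "\<And>j. j \<ge> 1 \<Longrightarrow> x j = y j \<or> w j \<le> b"
    and \<theta>: "\<And>j. j \<ge> 1 \<Longrightarrow> \<bar>x j\<bar> \<le> \<bar>\<theta> j\<bar> \<and> \<bar>y j\<bar> \<le> \<bar>\<theta> j\<bar> \<and> \<bar>x j - y j\<bar> \<le> \<bar>\<theta> j\<bar>"
    and R: "\<And>N. (\<Sum>j=1..N. (\<theta> j)\<^sup>2) \<le> R" and b: "b \<ge> 0" and bR: "b * R \<le> h / 2"
  shows "\<bar>prob {\<omega> \<in> space M. (\<Sum>\<^sub>\<infinity>j\<in>{1..}. w j * (x j + \<tau> * \<xi> j \<omega>)\<^sup>2) \<le> v}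
          - prob {\<omega> \<in> space M. (\<Sum>\<^sub>\<infinity>j\<in>{1..}. w j * (y j + \<tau> * \<xi> j \<omega>)\<^sup>2) \<le> v}\<bar>
         \<le> h * pi / (2 * a * sqrt k) + 16 * \<tau>\<^sup>2 * b\<^sup>2 * R / h\<^sup>2"
proof -
  have \<xi>m: "random_variable borel (\<xi> j)" if "j \<ge> 1" for j
    using indep that by (auto simp: indep_vars_def)
  have \<theta>R: "(\<theta> j)\<^sup>2 \<le> R" if "j \<ge> 1" for j
    using member_le_sum[of j "{1..j}" "\<lambda>j. (\<theta> j)\<^sup>2"] R[of j] that by simp
  have lim: "(\<lambda>N. prob {\<omega> \<in> space M. (\<Sum>j=1..N. w j * (z j + \<tau> * \<xi> j \<omega>)\<^sup>2) \<le> v})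
      \<longlonglongrightarrow> prob {\<omega> \<in> space M. (\<Sum>\<^sub>\<infinity>j\<in>{1..}. w j * (z j + \<tau> * \<xi> j \<omega>)\<^sup>2) \<le> v}"
    if z: "\<And>j. j \<ge> 1 \<Longrightarrow> \<bar>z j\<bar> \<le> \<bar>\<theta> j\<bar>" for z
  proof (rule prob_infsum_le_LIMSEQ)
    show "random_variable borel (\<lambda>\<omega>. w j * (z j + \<tau> * \<xi> j \<omega>)\<^sup>2)" if "j \<ge> 1" for j
      using \<xi>m[OF that] by measurable
    show "AE \<omega> in M. (\<lambda>j. w j * (z j + \<tau> * \<xi> j \<omega>)\<^sup>2) summable_on {1..}"
    proof (rule AE_noncentral_chi_square_summable[OF \<xi>m dist w])
      fix j :: nat assume j: "j \<ge> 1"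
      have "(z j)\<^sup>2 \<le> (\<theta> j)\<^sup>2" using z[OF j] by (simp add: abs_le_square_iff)
      then show "(z j)\<^sup>2 \<le> R" using \<theta>R[OF j] by linarith
    qed
  qed (use w in auto)
  have "(\<lambda>N. \<bar>prob {\<omega> \<in> space M. (\<Sum>j=1..N. w j * (x j + \<tau> * \<xi> j \<omega>)\<^sup>2) \<le> v}
          - prob {\<omega> \<in> space M. (\<Sum>j=1..N. w j * (y j + \<tau> * \<xi> j \<omega>)\<^sup>2) \<le> v}\<bar>)
      \<longlonglongrightarrow> \<bar>prob {\<omega> \<in> space M. (\<Sum>\<^sub>\<infinity>j\<in>{1..}. w j * (x j + \<tau> * \<xi> j \<omega>)\<^sup>2) \<le> v}
          - prob {\<omega> \<in> space M. (\<Sum>\<^sub>\<infinity>j\<in>{1..}. w j * (y j + \<tau> * \<xi> j \<omega>)\<^sup>2) \<le> v}\<bar>"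
    using \<theta> by (intro tendsto_intros lim) auto
  moreover have "\<bar>prob {\<omega> \<in> space M. (\<Sum>j=1..N. w j * (x j + \<tau> * \<xi> j \<omega>)\<^sup>2) \<le> v}
          - prob {\<omega> \<in> space M. (\<Sum>j=1..N. w j * (y j + \<tau> * \<xi> j \<omega>)\<^sup>2) \<le> v}\<bar>
         \<le> h * pi / (2 * a * sqrt k) + 16 * \<tau>\<^sup>2 * b\<^sup>2 * R / h\<^sup>2" if N: "N \<ge> 4 * k" for N
  proof (rule noncentral_chi_square_shift[where J = "{1..4 * k}" and \<theta> = \<theta>])
    show "indep_vars (\<lambda>_. borel) \<xi> {1..N}" by (rule indep_vars_subset[OF indep]) auto
  qed (use assms N in auto)
  ultimately show ?thesis
    by (intro LIMSEQ_le_const2) auto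
qed

subsection \<open>Nearest points of dilated Besov balls\<close>

lemma L2_01_mult_integrable:
  assumes "f \<in> L2_01" "g \<in> L2_01"
  shows "integrable (lebesgue_on {0<..<1}) (\<lambda>t. f t * g t)"
proof (rule Bochner_Integration.integrable_bound)
  show "integrable (lebesgue_on {0<..<1}) (\<lambda>t. (f t)\<^sup>2 + (g t)\<^sup>2)"
    using assms by (auto simp: L2_01_def)
  show "(\<lambda>t. f t * g t) \<in> borel_measurable (lebesgue_on {0<..<1})"
    using assms by (auto simp: L2_01_def)
  have "\<bar>a * b\<bar> \<le> a\<^sup>2 + b\<^sup>2" for a b :: real
  proof -
    have "2 * \<bar>a * b\<bar> \<le> a\<^sup>2 + b\<^sup>2"
      using sum_squares_bound[of "\<bar>a\<bar>" "\<bar>b\<bar>"] by (simp add: abs_mult mult.assoc)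
    then show ?thesis using abs_ge_zero[of "a * b"] by linarith
  qed
  then show "AE t in lebesgue_on {0<..<1}. norm (f t * g t) \<le> norm ((f t)\<^sup>2 + (g t)\<^sup>2)"
    by (auto simp del: abs_mult)
qed

lemma L2_01_lincomb:
  assumes "f \<in> L2_01" "g \<in> L2_01"
  shows "(\<lambda>t. a * f t + b * g t) \<in> L2_01"
proof -
  have "integrable (lebesgue_on {0<..<1}) (\<lambda>t. a\<^sup>2 * (f t)\<^sup>2 + b\<^sup>2 * (g t)\<^sup>2 + 2 * a * b * (f t * g t))"
    using assms L2_01_mult_integrable[OF assms] by (auto simp: L2_01_def)
  moreover have "(\<lambda>t. a\<^sup>2 * (f t)\<^sup>2 + b\<^sup>2 * (g t)\<^sup>2 + 2 * a * b * (f t * g t)) = (\<lambda>t. (a * f t + b * g t)\<^sup>2)"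
    by (auto simp: power2_eq_square algebra_simps)
  ultimately show ?thesis using assms by (auto simp: L2_01_def)
qed

lemma L2_01_diff: "f \<in> L2_01 \<Longrightarrow> g \<in> L2_01 \<Longrightarrow> (\<lambda>t. f t - g t) \<in> L2_01"
  using L2_01_lincomb[of f g 1 "-1"] by simp

lemma L2_01_scale: "f \<in> L2_01 \<Longrightarrow> (\<lambda>t. a * f t) \<in> L2_01"
  using L2_01_lincomb[of f f a 0] by simp

lemma L2_inner_commute: "L2_inner f g = L2_inner g f"
  by (simp add: L2_inner_def mult.commute)

lemma L2_inner_lincomb:
  assumes "f \<in> L2_01" "g \<in> L2_01" "h \<in> L2_01"
  shows "L2_inner (\<lambda>t. a * f t + b * g t) h = a * L2_inner f h + b * L2_inner g h"
proof -
  have "(\<lambda>t. (a * f t + b * g t) * h t) = (\<lambda>t. a * (f t * h t) + b * (g t * h t))"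
    by (simp add: algebra_simps)
  then show ?thesis
    unfolding L2_inner_def using assms by (simp add: L2_01_mult_integrable)
qed

lemma L2_inner_diff:
  "f \<in> L2_01 \<Longrightarrow> g \<in> L2_01 \<Longrightarrow> h \<in> L2_01 \<Longrightarrow> L2_inner (\<lambda>t. f t - g t) h = L2_inner f h - L2_inner g h"
  using L2_inner_lincomb[of f g h 1 "-1"] by simp

lemma L2_inner_scale: "f \<in> L2_01 \<Longrightarrow> h \<in> L2_01 \<Longrightarrow> L2_inner (\<lambda>t. a * f t) h = a * L2_inner f h"
  using L2_inner_lincomb[of f f h a 0] by simp

lemma L2_norm_nonneg: "L2_norm f \<ge> 0"
  by (simp add: L2_norm_def Bochner_Integration.integral_nonneg)

lemma L2_norm_sq: "(L2_norm f)\<^sup>2 = L2_inner f f"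
  by (simp add: L2_norm_def L2_inner_def Bochner_Integration.integral_nonneg power2_eq_square)

lemma L2_norm_sq_add_scale:
  assumes "f \<in> L2_01" "g \<in> L2_01"
  shows "(L2_norm (\<lambda>t. f t + a * g t))\<^sup>2 = (L2_norm f)\<^sup>2 + 2 * a * L2_inner f g + a\<^sup>2 * (L2_norm g)\<^sup>2"
proof -
  have m: "(\<lambda>t. 1 * f t + a * g t) \<in> L2_01" by (rule L2_01_lincomb[OF assms])
  have "L2_inner (\<lambda>t. 1 * f t + a * g t) (\<lambda>t. 1 * f t + a * g t)
      = 1 * L2_inner f (\<lambda>t. 1 * f t + a * g t) + a * L2_inner g (\<lambda>t. 1 * f t + a * g t)"
    by (rule L2_inner_lincomb[OF assms m])
  also have "L2_inner f (\<lambda>t. 1 * f t + a * g t) = L2_inner f f + a * L2_inner g f"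
    using L2_inner_lincomb[OF assms assms(1), of 1 a] by (subst L2_inner_commute) simp
  also have "L2_inner g (\<lambda>t. 1 * f t + a * g t) = L2_inner f g + a * L2_inner g g"
    using L2_inner_lincomb[OF assms assms(2), of 1 a] by (subst L2_inner_commute) simp
  finally show ?thesis
    unfolding L2_norm_sq by (simp add: L2_inner_commute[of g f] power2_eq_square algebra_simps)
qed

section \<open>Coefficients in an orthonormal basis\<close>

lemma orthonormal_basisD:
  assumes "orthonormal_basis \<phi>"
  shows "j \<ge> 1 \<Longrightarrow> \<phi> j \<in> L2_01"
    and "i \<ge> 1 \<Longrightarrow> j \<ge> 1 \<Longrightarrow> L2_inner (\<phi> i) (\<phi> j) = (if i = j then 1 else 0)"
    and "j \<ge> 1 \<Longrightarrow> L2_norm (\<phi> j) = 1"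
    and "f \<in> L2_01 \<Longrightarrow> L2_expansion \<phi> (\<lambda>j. L2_inner f (\<phi> j)) f"
proof -
  show "j \<ge> 1 \<Longrightarrow> L2_norm (\<phi> j) = 1"
    using assms L2_norm_sq[of "\<phi> j"] L2_norm_nonneg[of "\<phi> j"]
    by (auto simp: orthonormal_basis_def power2_eq_1_iff)
qed (use assms in \<open>auto simp: orthonormal_basis_def\<close>)

lemma L2_expansion_remainder:
  assumes \<phi>: "orthonormal_basis \<phi>" and f: "f \<in> L2_01"
  shows "(\<lambda>t. f t - (\<Sum>j=1..N. \<theta> j * \<phi> j t)) \<in> L2_01"
    and "i \<ge> 1 \<Longrightarrow> L2_inner (\<lambda>t. f t - (\<Sum>j=1..N. \<theta> j * \<phi> j t)) (\<phi> i)
           = L2_inner f (\<phi> i) - (if i \<le> N then \<theta> i else 0)"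
proof (induction N)
  case 0
  { case 1 show ?case using f by simp }
  { case 2 show ?case using 2 by simp }
next
  case (Suc N)
  let ?r = "\<lambda>t. f t - (\<Sum>j=1..N. \<theta> j * \<phi> j t)"
  have e: "(\<lambda>t. f t - (\<Sum>j=1..Suc N. \<theta> j * \<phi> j t)) = (\<lambda>t. 1 * ?r t + (- \<theta> (Suc N)) * \<phi> (Suc N) t)"
    by (auto simp: algebra_simps)
  have p: "\<phi> (Suc N) \<in> L2_01" using orthonormal_basisD(1)[OF \<phi>] by simp
  { case 1 show ?case unfolding e by (rule L2_01_lincomb[OF Suc.IH(1) p]) }
  { case 2
    have "L2_inner (\<lambda>t. 1 * ?r t + (- \<theta> (Suc N)) * \<phi> (Suc N) t) (\<phi> i)
      = 1 * L2_inner ?r (\<phi> i) + (- \<theta> (Suc N)) * L2_inner (\<phi> (Suc N)) (\<phi> i)"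
      by (rule L2_inner_lincomb[OF Suc.IH(1) p orthonormal_basisD(1)[OF \<phi> 2]])
    then show ?case
      unfolding e using Suc.IH(2)[OF 2] orthonormal_basisD(2)[OF \<phi>, of "Suc N" i] 2 by auto }
qed

text \<open>Once \<open>N\<close> has passed \<open>i\<close>, the remainder has the fixed
  coefficient \<open>L2_inner f (\<phi> i) - \<theta> i\<close>. Removing its projection on
  \<open>\<phi> i\<close> shows that this is at most the norm of the remainder, which tends to
  0.\<close>

lemma L2_expansion_unique:
  assumes \<phi>: "orthonormal_basis \<phi>" and f: "f \<in> L2_01" and e: "L2_expansion \<phi> \<theta> f" and i: "i \<ge> 1"
  shows "\<theta> i = L2_inner f (\<phi> i)"
proof -
  let ?r = "\<lambda>N t. f t - (\<Sum>j=1..N. \<theta> j * \<phi> j t)"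
  have "(\<lambda>N. L2_norm (?r N)) \<longlonglongrightarrow> 0" using e by (simp add: L2_expansion_def)
  moreover have "\<bar>L2_inner f (\<phi> i) - \<theta> i\<bar> \<le> L2_norm (?r N)" if N: "N \<ge> i" for N
  proof -
    let ?c = "L2_inner (?r N) (\<phi> i)"
    have c: "?c = L2_inner f (\<phi> i) - \<theta> i" using L2_expansion_remainder(2)[OF \<phi> f i] N by simp
    have "0 \<le> (L2_norm (\<lambda>t. ?r N t + (- ?c) * \<phi> i t))\<^sup>2" by simp
    also have "\<dots> = (L2_norm (?r N))\<^sup>2 - ?c\<^sup>2"
      by (subst L2_norm_sq_add_scale[OF L2_expansion_remainder(1)[OF \<phi> f] orthonormal_basisD(1)[OF \<phi> i]])
         (simp add: orthonormal_basisD(3)[OF \<phi> i] power2_eq_square)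
    finally have "?c\<^sup>2 \<le> (L2_norm (?r N))\<^sup>2" by simp
    then show ?thesis unfolding c using L2_norm_nonneg[of "?r N"] by (simp add: abs_le_square_iff[symmetric])
  qed
  ultimately have "\<bar>L2_inner f (\<phi> i) - \<theta> i\<bar> \<le> 0"
    by (intro LIMSEQ_le_const) auto
  then show ?thesis by simp
qed

lemma L2_Bessel:
  assumes \<phi>: "orthonormal_basis \<phi>" and f: "f \<in> L2_01"
  shows "(\<Sum>j=1..N. (L2_inner f (\<phi> j))\<^sup>2) \<le> (L2_norm f)\<^sup>2"
proof -
  let ?\<theta> = "\<lambda>j. L2_inner f (\<phi> j)"
  let ?r = "\<lambda>N t. f t - (\<Sum>j=1..N. ?\<theta> j * \<phi> j t)"
  have "(L2_norm (?r N))\<^sup>2 = (L2_norm f)\<^sup>2 - (\<Sum>j=1..N. (?\<theta> j)\<^sup>2)"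
  proof (induction N)
    case (Suc N)
    have e: "?r (Suc N) = (\<lambda>t. ?r N t + (- ?\<theta> (Suc N)) * \<phi> (Suc N) t)"
      by (auto simp: algebra_simps)
    have "L2_inner (?r N) (\<phi> (Suc N)) = ?\<theta> (Suc N)"
      using L2_expansion_remainder(2)[OF \<phi> f, where i = "Suc N" and N = N and \<theta> = ?\<theta>] by simp
    then show ?case
      unfolding e using Suc.IH orthonormal_basisD(3)[OF \<phi>, of "Suc N"]
      by (subst L2_norm_sq_add_scale[OF L2_expansion_remainder(1)[OF \<phi> f] orthonormal_basisD(1)[OF \<phi>]])
         (simp_all add: power2_eq_square)
  qed simp
  then show ?thesis using zero_le_power2[of "L2_norm (?r N)"] by linarith
qed

lemma L2_coefficients_summable:
  assumes \<phi>: "orthonormal_basis \<phi>" and f: "f \<in> L2_01" and J: "J \<subseteq> {1..}"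
  shows "(\<lambda>j. (L2_inner f (\<phi> j))\<^sup>2) summable_on J"
    and "(\<Sum>\<^sub>\<infinity>j\<in>J. (L2_inner f (\<phi> j))\<^sup>2) \<le> (L2_norm f)\<^sup>2"
proof -
  have le: "(\<Sum>j\<in>F. (L2_inner f (\<phi> j))\<^sup>2) \<le> (L2_norm f)\<^sup>2" if F: "finite F" "F \<subseteq> J" for F
  proof -
    have "(\<Sum>j\<in>F. (L2_inner f (\<phi> j))\<^sup>2) \<le> (\<Sum>j=1..Max (insert 0 F). (L2_inner f (\<phi> j))\<^sup>2)"
      using F J by (intro sum_mono2) auto
    then show ?thesis using L2_Bessel[OF \<phi> f] order_trans by blast
  qed
  show s: "(\<lambda>j. (L2_inner f (\<phi> j))\<^sup>2) summable_on J"
    using le by (intro nonneg_bdd_above_summable_on) (auto intro!: bdd_aboveI)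
  show "(\<Sum>\<^sub>\<infinity>j\<in>J. (L2_inner f (\<phi> j))\<^sup>2) \<le> (L2_norm f)\<^sup>2"
    by (rule infsum_le_finite_sums[OF s le])
qed

text \<open>Uniqueness of expansions replaces the existentially quantified \<open>\<theta>\<close>
  by the inner products, and dilation multiplies every tail by \<open>\<gamma>\<^sup>2\<close>.
  Membership becomes a family of tail inequalities that can be checked after a change of one
  coordinate.\<close>

lemma dilate_Besov_ball_iff:
  assumes \<phi>: "orthonormal_basis \<phi>" and \<gamma>: "\<gamma> > 0"
  shows "g \<in> dilate \<gamma> (Besov_ball \<phi> s P0) \<longleftrightarrow> g \<in> L2_01 \<and>
     (\<forall>x>0. x powr (2 * s) * (\<Sum>\<^sub>\<infinity>j\<in>{j. 1 \<le> j \<and> x < real j}. (L2_inner g (\<phi> j))\<^sup>2) \<le> \<gamma>\<^sup>2 * P0)"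
    (is "_ \<longleftrightarrow> _ \<and> (\<forall>x>0. ?B \<gamma> g x)")
proof -
  let ?T = "\<lambda>\<theta> x. \<Sum>\<^sub>\<infinity>j\<in>{j. 1 \<le> j \<and> x < real j}. (\<theta> j)\<^sup>2"
  have ball: "h \<in> Besov_ball \<phi> s P0 \<longleftrightarrow> h \<in> L2_01 \<and> (\<forall>x>0. ?B 1 h x)" (is "?l \<longleftrightarrow> ?r") for h
  proof
    assume ?l
    then obtain \<theta> where h: "h \<in> L2_01" and e: "L2_expansion \<phi> \<theta> h"
      and \<theta>: "\<And>x. x > 0 \<Longrightarrow> x powr (2 * s) * ?T \<theta> x \<le> P0"
      by (auto simp only: Besov_ball_def mem_Collect_eq)
    have "?T (\<lambda>j. L2_inner h (\<phi> j)) x = ?T \<theta> x" for x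
      using L2_expansion_unique[OF \<phi> h e] by (intro infsum_cong) auto
    then show ?r using h \<theta> by simp
  next
    assume r: ?r
    then show ?l
      unfolding Besov_ball_def
      by (intro CollectI conjI exI[of _ "\<lambda>j. L2_inner h (\<phi> j)"] orthonormal_basisD(4)[OF \<phi>]) simp_all
  qed
  have sc: "?B \<gamma> (\<lambda>t. \<gamma> * h t) x \<longleftrightarrow> ?B 1 h x" if h: "h \<in> L2_01" for h x
  proof -
    have "?T (\<lambda>j. L2_inner (\<lambda>t. \<gamma> * h t) (\<phi> j)) x
        = (\<Sum>\<^sub>\<infinity>j\<in>{j. 1 \<le> j \<and> x < real j}. \<gamma>\<^sup>2 * (L2_inner h (\<phi> j))\<^sup>2)"
      using L2_inner_scale[OF h orthonormal_basisD(1)[OF \<phi>]] by (intro infsum_cong) (simp add: power_mult_distrib)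
    also have "\<dots> = \<gamma>\<^sup>2 * ?T (\<lambda>j. L2_inner h (\<phi> j)) x"
      by (rule infsum_cmult_right')
    finally have eq: "x powr (2 * s) * ?T (\<lambda>j. L2_inner (\<lambda>t. \<gamma> * h t) (\<phi> j)) x
        = \<gamma>\<^sup>2 * (x powr (2 * s) * ?T (\<lambda>j. L2_inner h (\<phi> j)) x)" by (simp only: mult.left_commute)
    show ?thesis unfolding eq using \<gamma> by simp
  qed
  show ?thesis
  proof
    assume "g \<in> dilate \<gamma> (Besov_ball \<phi> s P0)"
    then obtain h where h: "h \<in> Besov_ball \<phi> s P0" and g: "g = (\<lambda>t. \<gamma> * h t)" unfolding dilate_def by blast
    show "g \<in> L2_01 \<and> (\<forall>x>0. ?B \<gamma> g x)"
      unfolding g using h sc unfolding ball by (simp add: L2_01_scale)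
  next
    assume g: "g \<in> L2_01 \<and> (\<forall>x>0. ?B \<gamma> g x)"
    define h where "h = (\<lambda>t. inverse \<gamma> * g t)"
    have gh: "(\<lambda>t. \<gamma> * h t) = g" using \<gamma> by (simp add: h_def fun_eq_iff)
    have hL: "h \<in> L2_01" unfolding h_def by (rule L2_01_scale[OF conjunct1[OF g]])
    have "h \<in> Besov_ball \<phi> s P0"
      unfolding ball
    proof (intro conjI allI impI hL)
      fix x :: real assume "x > 0"
      then have "?B \<gamma> (\<lambda>t. \<gamma> * h t) x" unfolding gh using g by blast
      then show "?B 1 h x" by (rule iffD1[OF sc[OF hL]])
    qed
    then show "g \<in> dilate \<gamma> (Besov_ball \<phi> s P0)" unfolding dilate_def using gh by blast
  qed
qed

text \<open>By orthonormality, moving \<open>g\<close> along \<open>\<phi> j\<close> alters the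
  squared distance to \<open>f\<close> only in coordinate \<open>j\<close>. Minimality over
  \<open>V\<close> thus yields a scalar comparison for every admissible new value
  \<open>c\<close>.\<close>

lemma nearest_point_single_coordinate:
  assumes \<phi>: "orthonormal_basis \<phi>" and f: "f \<in> L2_01" and V: "V \<subseteq> L2_01" and g: "nearest_point V f g"
    and j: "j \<ge> 1" and h: "(\<lambda>t. g t + (c - L2_inner g (\<phi> j)) * \<phi> j t) \<in> V"
  shows "(L2_inner g (\<phi> j) - L2_inner f (\<phi> j))\<^sup>2 \<le> (c - L2_inner f (\<phi> j))\<^sup>2"
proof -
  let ?a = "c - L2_inner g (\<phi> j)"
  have gL: "g \<in> L2_01" using g V by (auto simp: nearest_point_def)
  have p: "\<phi> j \<in> L2_01" using orthonormal_basisD(1)[OF \<phi> j] .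
  have "L2_norm (\<lambda>t. g t - f t) \<le> L2_norm (\<lambda>t. (g t + ?a * \<phi> j t) - f t)"
  proof -
    have "bdd_below ((\<lambda>h. L2_norm (\<lambda>t. h t - f t)) ` V)"
      by (rule bdd_belowI[of _ 0]) (auto simp: L2_norm_nonneg)
    from cINF_lower[OF this h] show ?thesis using g by (simp add: nearest_point_def)
  qed
  then have "(L2_norm (\<lambda>t. g t - f t))\<^sup>2 \<le> (L2_norm (\<lambda>t. (g t + ?a * \<phi> j t) - f t))\<^sup>2"
    by (intro power_mono L2_norm_nonneg)
  also have "(\<lambda>t. (g t + ?a * \<phi> j t) - f t) = (\<lambda>t. (g t - f t) + ?a * \<phi> j t)" by (auto simp: algebra_simps)
  also have "(L2_norm (\<lambda>t. (g t - f t) + ?a * \<phi> j t))\<^sup>2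
      = (L2_norm (\<lambda>t. g t - f t))\<^sup>2 + 2 * ?a * (L2_inner g (\<phi> j) - L2_inner f (\<phi> j)) + ?a\<^sup>2"
    by (subst L2_norm_sq_add_scale[OF L2_01_diff[OF gL f] p])
       (simp add: L2_inner_diff[OF gL f p] orthonormal_basisD(3)[OF \<phi> j])
  finally show ?thesis by (simp add: power2_eq_square algebra_simps)
qed

text \<open>Both claims come from changing a single coordinate of \<open>g\<close>: moving it towards the one of \<open>f\<close>
  without increasing its modulus stays in the ball, and for \<open>j \<le> m\<close> the constraints that see
  coordinate \<open>j\<close> hold for every function whose coordinates are dominated by those of \<open>f\<close>.\<close>

lemma nearest_point_Besov_ball:
  assumes \<phi>: "orthonormal_basis \<phi>" and f: "f \<in> L2_01" and \<gamma>: "\<gamma> > 0" and s: "s > 0"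
    and g: "nearest_point (dilate \<gamma> (Besov_ball \<phi> s P0)) f g"
    and m: "real m powr (2 * s) * (L2_norm f)\<^sup>2 \<le> \<gamma>\<^sup>2 * P0"
    and j: "j \<ge> 1"
  shows "\<bar>L2_inner g (\<phi> j)\<bar> \<le> \<bar>L2_inner f (\<phi> j)\<bar>"
    and "\<bar>L2_inner f (\<phi> j) - L2_inner g (\<phi> j)\<bar> \<le> \<bar>L2_inner f (\<phi> j)\<bar>"
    and "j \<le> m \<Longrightarrow> L2_inner g (\<phi> j) = L2_inner f (\<phi> j)"
proof -
  let ?V = "dilate \<gamma> (Besov_ball \<phi> s P0)"
  note iff = dilate_Besov_ball_iff[OF \<phi> \<gamma>, of _ s P0]
  have VL: "?V \<subseteq> L2_01" using iff by blast
  have gV: "g \<in> ?V" using g by (simp add: nearest_point_def)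
  then have gL: "g \<in> L2_01" using VL by blast
  define h where "h j c = (\<lambda>t. g t + (c - L2_inner g (\<phi> j)) * \<phi> j t)" for j c
  have hL: "h j c \<in> L2_01" if "j \<ge> 1" for j c
    unfolding h_def using L2_01_lincomb[OF gL orthonormal_basisD(1)[OF \<phi> that], of 1] by simp
  have hc: "L2_inner (h j c) (\<phi> i) = (if i = j then c else L2_inner g (\<phi> i))" if "j \<ge> 1" "i \<ge> 1" for i j c
    unfolding h_def
    using L2_inner_lincomb[OF gL orthonormal_basisD(1)[OF \<phi> that(1)] orthonormal_basisD(1)[OF \<phi> that(2)], of 1]
      orthonormal_basisD(2)[OF \<phi> that] by auto
  have tail: "x powr (2 * s) * (\<Sum>\<^sub>\<infinity>i\<in>{i. 1 \<le> i \<and> x < real i}. (L2_inner u (\<phi> i))\<^sup>2) \<le> \<gamma>\<^sup>2 * P0"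
    if x: "x > 0" and u: "u \<in> L2_01" and le: "\<And>i. 1 \<le> i \<Longrightarrow> x < real i \<Longrightarrow> (L2_inner u (\<phi> i))\<^sup>2 \<le> (L2_inner g (\<phi> i))\<^sup>2"
    for x u
  proof -
    have "(\<Sum>\<^sub>\<infinity>i\<in>{i. 1 \<le> i \<and> x < real i}. (L2_inner u (\<phi> i))\<^sup>2)
        \<le> (\<Sum>\<^sub>\<infinity>i\<in>{i. 1 \<le> i \<and> x < real i}. (L2_inner g (\<phi> i))\<^sup>2)"
      using le by (intro infsum_mono L2_coefficients_summable(1)[OF \<phi>] u gL) auto
    then have "x powr (2 * s) * (\<Sum>\<^sub>\<infinity>i\<in>{i. 1 \<le> i \<and> x < real i}. (L2_inner u (\<phi> i))\<^sup>2)
        \<le> x powr (2 * s) * (\<Sum>\<^sub>\<infinity>i\<in>{i. 1 \<le> i \<and> x < real i}. (L2_inner g (\<phi> i))\<^sup>2)"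
      by (rule mult_left_mono) simp
    also have "\<dots> \<le> \<gamma>\<^sup>2 * P0" using gV iff x by blast
    finally show ?thesis .
  qed
  have shrink: "\<bar>L2_inner g (\<phi> j)\<bar> \<le> \<bar>L2_inner f (\<phi> j)\<bar> \<and> \<bar>L2_inner f (\<phi> j) - L2_inner g (\<phi> j)\<bar> \<le> \<bar>L2_inner f (\<phi> j)\<bar>"
    if j: "j \<ge> 1" for j
  proof -
    let ?a = "L2_inner f (\<phi> j)" and ?b = "L2_inner g (\<phi> j)"
    have *: "(?b - ?a)\<^sup>2 \<le> (c - ?a)\<^sup>2" if c: "\<bar>c\<bar> \<le> \<bar>?b\<bar>" for c
    proof (rule nearest_point_single_coordinate[OF \<phi> f VL g j])
      have "h j c \<in> ?V" unfolding iff
      proof (intro conjI allI impI hL[OF j])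
        fix x :: real assume "x > 0"
        then show "x powr (2 * s) * (\<Sum>\<^sub>\<infinity>i\<in>{i. 1 \<le> i \<and> x < real i}. (L2_inner (h j c) (\<phi> i))\<^sup>2) \<le> \<gamma>\<^sup>2 * P0"
        proof (rule tail[OF _ hL[OF j]])
          show "(L2_inner (h j c) (\<phi> i))\<^sup>2 \<le> (L2_inner g (\<phi> i))\<^sup>2" if "1 \<le> i" for i
            using c hc[OF j that] by (simp add: abs_le_square_iff)
        qed
      qed
      then show "(\<lambda>t. g t + (c - ?b) * \<phi> j t) \<in> ?V" by (simp add: h_def)
    qed
    \<comment> \<open>Two competitors suffice: \<open>c = 0\<close> bounds the difference, and if
      \<open>?b\<close> exceeded \<open>?a\<close> in modulus, \<open>c = ?a\<close> would be
      admissible and force \<open>?b = ?a\<close>.\<close>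
    have "\<bar>?b - ?a\<bar> \<le> \<bar>?a\<bar>" using *[of 0] by (simp add: abs_le_square_iff)
    moreover have "\<bar>?b\<bar> \<le> \<bar>?a\<bar>"
    proof (rule ccontr)
      assume "\<not> \<bar>?b\<bar> \<le> \<bar>?a\<bar>"
      with *[of ?a] show False by simp
    qed
    ultimately show ?thesis by (simp add: abs_minus_commute)
  qed
  from shrink[OF j] show "\<bar>L2_inner g (\<phi> j)\<bar> \<le> \<bar>L2_inner f (\<phi> j)\<bar>"
    and "\<bar>L2_inner f (\<phi> j) - L2_inner g (\<phi> j)\<bar> \<le> \<bar>L2_inner f (\<phi> j)\<bar>" by auto
  assume jm: "j \<le> m"
  let ?c = "L2_inner f (\<phi> j)"
  have "(L2_inner g (\<phi> j) - ?c)\<^sup>2 \<le> (?c - ?c)\<^sup>2"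
  proof (rule nearest_point_single_coordinate[OF \<phi> f VL g j])
    have "h j ?c \<in> ?V" unfolding iff
    proof (intro conjI allI impI hL[OF j])
      fix x :: real assume x: "x > 0"
      let ?T = "\<Sum>\<^sub>\<infinity>i\<in>{i. 1 \<le> i \<and> x < real i}. (L2_inner (h j ?c) (\<phi> i))\<^sup>2"
      \<comment> \<open>Below \<open>m\<close> the weight is at most \<open>m powr (2 * s)\<close>
        and the tail at most the squared norm of \<open>f\<close>, which is what \<open>m\<close>
        was assumed for. From \<open>m\<close> on the tail starts beyond \<open>j\<close> and is
        still that of \<open>g\<close>.\<close>
      show "x powr (2 * s) * ?T \<le> \<gamma>\<^sup>2 * P0"
      proof (cases "x < real m")
        case True
        have "?T \<le> (\<Sum>\<^sub>\<infinity>i\<in>{i. 1 \<le> i \<and> x < real i}. (L2_inner f (\<phi> i))\<^sup>2)"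
        proof (intro infsum_mono L2_coefficients_summable(1)[OF \<phi>] f hL[OF j])
          fix i assume "i \<in> {i. 1 \<le> i \<and> x < real i}"
          then have "1 \<le> i" by simp
          then show "(L2_inner (h j ?c) (\<phi> i))\<^sup>2 \<le> (L2_inner f (\<phi> i))\<^sup>2"
            using shrink hc[OF j] by (auto simp: abs_le_square_iff)
        qed auto
        also have "\<dots> \<le> (L2_norm f)\<^sup>2" by (rule L2_coefficients_summable(2)[OF \<phi> f]) auto
        finally have "x powr (2 * s) * ?T \<le> real m powr (2 * s) * (L2_norm f)\<^sup>2"
          using x True s by (intro mult_mono powr_mono2) (auto intro: infsum_nonneg)
        then show ?thesis using m by linarith
      next
        case False
        show ?thesis
        proof (rule tail[OF x hL[OF j]])
          show "(L2_inner (h j ?c) (\<phi> i))\<^sup>2 \<le> (L2_inner g (\<phi> i))\<^sup>2" if "1 \<le> i" "x < real i" for i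
            using hc[OF j that(1)] that False jm by auto
        qed
      qed
    qed
    then show "(\<lambda>t. g t + (?c - L2_inner g (\<phi> j)) * \<phi> j t) \<in> ?V" by (simp add: h_def)
  qed
  then show "L2_inner g (\<phi> j) = ?c" by simp
qed

subsection \<open>Size of the weights\<close>

text \<open>A divergent \<open>infsum\<close> has the default value 0, which the positive lower
  bound in \<open>A2\<close> excludes.\<close>

lemma kappa_power4_summable:
  assumes A2: "A2 \<sigma> \<kappa>" and n: "n \<ge> 1"
  shows "(\<lambda>j. (\<kappa> j n) ^ 4) summable_on {1..}"
proof (rule ccontr)
  assume "\<not> ?thesis"
  then have "A_seq \<sigma> \<kappa> n = 0" by (simp add: A_seq_def infsum_not_exists)
  then show False using A2 n unfolding A2_def by (metis less_asym)
qed

lemma kappa_antimono: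
  assumes A1: "A1 \<kappa>" and n: "n \<ge> 1" and ij: "1 \<le> i" "i \<le> j"
  shows "(\<kappa> j n)\<^sup>2 \<le> (\<kappa> i n)\<^sup>2"
  using ij(2)
proof (induction rule: dec_induct)
  case (step l)
  have "(\<kappa> (Suc l) n)\<^sup>2 \<le> (\<kappa> l n)\<^sup>2" using A1 n ij(1) step by (simp add: A1_def)
  then show ?case using step.IH by linarith
qed simp

lemma kappa_antimono4:
  assumes A1: "A1 \<kappa>" and n: "n \<ge> 1" and ij: "1 \<le> i" "i \<le> j"
  shows "(\<kappa> j n) ^ 4 \<le> (\<kappa> i n) ^ 4"
  using power_mono[OF kappa_antimono[OF assms], of 2] by (simp flip: power_mult)

text \<open>The first \<open>m\<close> fourth powers are each at least the \<open>m\<close>-th, and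
  their total is of order \<open>1 / n\<^sup>2\<close> by \<open>A2\<close>. This makes the weights
  beyond the cutoff small.\<close>

lemma kappa_upper_bound:
  assumes A1: "A1 \<kappa>" and A2: "A2 \<sigma> \<kappa>" and \<sigma>: "\<sigma> > 0"
  shows "\<exists>C>0. \<forall>n\<ge>1. \<forall>m\<ge>1. real m * (\<kappa> m n) ^ 4 \<le> C / (real n)\<^sup>2"
proof -
  obtain C2 where C2: "C2 > 0" "\<And>n. n \<ge> 1 \<Longrightarrow> A_seq \<sigma> \<kappa> n < C2"
    using A2 by (auto simp: A2_def)
  have "real m * (\<kappa> m n) ^ 4 \<le> C2 * \<sigma> ^ 4 / (real n)\<^sup>2" if n: "n \<ge> 1" and m: "m \<ge> 1" for n m
  proof -
    have "real m * (\<kappa> m n) ^ 4 = (\<Sum>j=1..m. (\<kappa> m n) ^ 4)" by simp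
    also have "\<dots> \<le> (\<Sum>j=1..m. (\<kappa> j n) ^ 4)"
      using kappa_antimono4[OF A1 n] by (intro sum_mono) auto
    also have "\<dots> \<le> (\<Sum>\<^sub>\<infinity>j\<in>{1..}. (\<kappa> j n) ^ 4)"
      by (intro finite_sum_le_infsum kappa_power4_summable[OF A2 n]) auto
    also have "\<dots> = A_seq \<sigma> \<kappa> n * \<sigma> ^ 4 / (real n)\<^sup>2"
      using n \<sigma> by (simp add: A_seq_def)
    also have "\<dots> \<le> C2 * \<sigma> ^ 4 / (real n)\<^sup>2"
      using C2(2)[OF n] by (intro divide_right_mono mult_right_mono) auto
    finally show ?thesis .
  qed
  moreover have "C2 * \<sigma> ^ 4 > 0" using C2 \<sigma> by simp
  ultimately show ?thesis by blast
qed

text \<open>By the second half of \<open>A5\<close> a window around \<open>k_seq \<kappa> n\<close> carries at least half of the sum of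
  the fourth powers, and its first index \<open>N\<close> is comparable to its length, whence \<open>N * (\<kappa> N n) ^ 4\<close> is at least of order
  \<open>1 / n\<^sup>2\<close>; the \<open>k\<close> below is \<open>N div 4\<close>.\<close>

lemma kappa_lower_bound:
  assumes A1: "A1 \<kappa>" and A2: "A2 \<sigma> \<kappa>" and A5: "A5 \<sigma> \<kappa>" and \<sigma>: "\<sigma> > 0"
    and k: "filterlim (\<lambda>n. real (k_seq \<kappa> n)) at_top sequentially"
  shows "\<exists>c>0. \<forall>\<^sub>F n in sequentially. \<exists>k>0. \<forall>j. 1 \<le> j \<and> j \<le> 4 * k \<longrightarrow> c / (real n)\<^sup>2 \<le> real k * (\<kappa> j n) ^ 4"
proof -
  obtain C1 where C1: "C1 > 0" "\<And>n. n \<ge> 1 \<Longrightarrow> C1 < A_seq \<sigma> \<kappa> n"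
    using A2 by (auto simp: A2_def)
  define F where "F \<delta> n = inverse (A_seq \<sigma> \<kappa> n) * ((real n)\<^sup>2 / \<sigma> ^ 4 * (\<Sum>j\<in>window \<kappa> \<delta> n. (\<kappa> j n) ^ 4))" for \<delta> n
  obtain L where L: "\<forall>\<^sub>F \<delta> in at_right 0. F \<delta> \<longlonglongrightarrow> L \<delta>" "(L \<longlongrightarrow> 1) (at_right 0)"
    using A5 unfolding A5_def iterated_limit_def F_def by blast
  have "\<forall>\<^sub>F \<delta> in at_right 0. L \<delta> > 1 / 2" using L(2) by (rule order_tendstoD) simp
  moreover have "\<forall>\<^sub>F \<delta> in at_right (0::real). \<delta> > 0" by (rule eventually_at_right_less)
  ultimately have "\<forall>\<^sub>F \<delta> in at_right 0. F \<delta> \<longlonglongrightarrow> L \<delta> \<and> L \<delta> > 1 / 2 \<and> \<delta> > 0"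
    using L(1) by eventually_elim auto
  \<comment> \<open>A single \<delta>, independent of \<open>n\<close>, is frozen here; from now on
    only the inner limit is used.\<close>
  then obtain \<delta> where \<delta>: "F \<delta> \<longlonglongrightarrow> L \<delta>" "L \<delta> > 1 / 2" "\<delta> > 0"
    using eventually_happens' trivial_limit_at_right_real by blast
  \<comment> \<open>One factor \<delta> comes from the window length
    \<open>k_seq \<kappa> n / \<delta>\<close>, the other from
    \<open>N > \<delta> * k_seq \<kappa> n\<close>. The 16 is 2 for half of the sum of fourth powers
    times 8 for \<open>N \<le> 8 * q\<close>.\<close>
  define c where "c = C1 * \<sigma> ^ 4 * \<delta>\<^sup>2 / 16"
  have c: "c > 0" using C1 \<sigma> \<delta> by (simp add: c_def)
  have ev: "\<forall>\<^sub>F n in sequentially. F \<delta> n > 1 / 2" using \<delta>(1,2) by (rule order_tendstoD)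
  have "\<forall>\<^sub>F n in sequentially. 4 / \<delta> \<le> real (k_seq \<kappa> n)"
    using k by (simp add: filterlim_at_top)
  with ev eventually_ge_at_top[of 1]
  have "\<forall>\<^sub>F n in sequentially. \<exists>k>0. \<forall>j. 1 \<le> j \<and> j \<le> 4 * k \<longrightarrow> c / (real n)\<^sup>2 \<le> real k * (\<kappa> j n) ^ 4"
  proof eventually_elim
    case (elim n)
    let ?k = "real (k_seq \<kappa> n)"
    define W where "W = (\<Sum>j\<in>window \<kappa> \<delta> n. (\<kappa> j n) ^ 4)"
    define N where "N = nat \<lfloor>\<delta> * ?k\<rfloor> + 1"
    define q where "q = N div 4"
    have dk: "\<delta> * ?k \<ge> 4" using elim(3) \<delta>(3) by (simp add: field_simps)
    have kpos: "?k > 0" using dk \<delta>(3) by (smt (verit) mult_nonneg_nonpos)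
    have N: "\<delta> * ?k < real N" "N \<ge> 4" unfolding N_def using dk by linarith+
    \<comment> \<open>The bound \<open>N \<ge> 4\<close> makes \<open>q\<close> positive, and the
      remainder of the division, at most 3, is then below \<open>4 * q\<close>.\<close>
    have q: "q > 0" "4 * q \<le> N" "N \<le> 8 * q" unfolding q_def using N(2) by presburger+
    have win: "j \<in> window \<kappa> \<delta> n \<Longrightarrow> N \<le> j" for j
      unfolding window_def N_def using dk by (auto simp: Suc_le_eq nat_less_iff floor_less_iff)
    have win2: "window \<kappa> \<delta> n \<subseteq> {1..nat \<lfloor>?k / \<delta>\<rfloor>}"
    proof
      fix j assume j: "j \<in> window \<kappa> \<delta> n"
      then have "real j \<le> ?k / \<delta>" by (simp add: window_def)
      then show "j \<in> {1..nat \<lfloor>?k / \<delta>\<rfloor>}" using win[OF j] N(2) by (simp add: le_nat_floor)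
    qed
    have card: "real (card (window \<kappa> \<delta> n)) \<le> ?k / \<delta>"
    proof -
      have "card (window \<kappa> \<delta> n) \<le> nat \<lfloor>?k / \<delta>\<rfloor>" using card_mono[OF _ win2] by simp
      also have "real (nat \<lfloor>?k / \<delta>\<rfloor>) \<le> ?k / \<delta>" using \<delta>(3) by (intro of_nat_floor) simp
      finally show ?thesis by simp
    qed
    have "W \<le> (\<Sum>j\<in>window \<kappa> \<delta> n. (\<kappa> N n) ^ 4)"
      unfolding W_def using win N(2) by (intro sum_mono kappa_antimono4[OF A1 elim(2)]) auto
    also have "\<dots> = real (card (window \<kappa> \<delta> n)) * (\<kappa> N n) ^ 4" by simp
    also have "\<dots> \<le> ?k / \<delta> * (\<kappa> N n) ^ 4" by (intro mult_right_mono card) simp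
    finally have W: "W * \<delta> \<le> ?k * (\<kappa> N n) ^ 4" using \<delta>(3) by (simp add: field_simps)
    have A: "A_seq \<sigma> \<kappa> n > C1" "A_seq \<sigma> \<kappa> n > 0" using C1 elim(2) by (auto intro: less_trans)
    have "1 / 2 < inverse (A_seq \<sigma> \<kappa> n) * ((real n)\<^sup>2 / \<sigma> ^ 4 * W)" using elim(1) by (simp add: F_def W_def)
    from mult_strict_left_mono[OF this A(2)] have "A_seq \<sigma> \<kappa> n / 2 < (real n)\<^sup>2 / \<sigma> ^ 4 * W"
      using A(2) by (simp add: mult.assoc[symmetric])
    then have "C1 / 2 < (real n)\<^sup>2 / \<sigma> ^ 4 * W" using A(1) by linarith
    then have W2: "C1 * \<sigma> ^ 4 / (2 * (real n)\<^sup>2) < W" using \<sigma> elim(2) by (simp add: field_simps)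
    have "c / (real n)\<^sup>2 \<le> real q * (\<kappa> j n) ^ 4" if j: "1 \<le> j" "j \<le> 4 * q" for j
    proof -
      have "c / (real n)\<^sup>2 = C1 * \<sigma> ^ 4 / (2 * (real n)\<^sup>2) * \<delta> * \<delta> / 8"
        by (simp add: c_def power2_eq_square)
      also have "\<dots> \<le> W * \<delta> * \<delta> / 8"
        using W2 \<delta>(3) by (intro divide_right_mono mult_right_mono) auto
      also have "\<dots> \<le> (?k * (\<kappa> N n) ^ 4) * \<delta> / 8"
        using W \<delta>(3) by (intro divide_right_mono mult_right_mono) auto
      also have "\<dots> = (\<delta> * ?k) * (\<kappa> N n) ^ 4 / 8" by simp
      also have "\<dots> \<le> (8 * real q) * (\<kappa> N n) ^ 4 / 8"
        using N(1) q(3) by (intro divide_right_mono mult_right_mono) auto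
      also have "\<dots> \<le> real q * (\<kappa> j n) ^ 4"
        using kappa_antimono4[OF A1 elim(2) j(1), of N] j(2) q(2) by (simp add: mult_left_mono)
      finally show ?thesis .
    qed
    then show ?case using q(1) by blast
  qed
  then show ?thesis using c by blast
qed

subsection \<open>Stability of the quadratic tests\<close>

lemma type2_error_eq_prob_infsum:
  assumes "\<And>y. Kn y \<longleftrightarrow> T_stat \<sigma> \<kappa> n y > u"
  shows "type2_error M \<xi> \<sigma> \<phi> n Kn f
    = measure M {\<omega> \<in> space M. (\<Sum>\<^sub>\<infinity>j\<in>{1..}. (\<kappa> j n)\<^sup>2 * (L2_inner f (\<phi> j) + \<sigma> / sqrt (real n) * \<xi> j \<omega>)\<^sup>2)
        \<le> u + \<sigma>\<^sup>2 / real n * (\<Sum>\<^sub>\<infinity>j\<in>{1..}. (\<kappa> j n)\<^sup>2)}"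
  unfolding type2_error_def assms T_stat_def observation_def by (simp add: not_less diff_le_eq)

lemma L2_inner_zero_left: "L2_inner (\<lambda>t. 0) g = 0"
  by (simp add: L2_inner_def)

text \<open>The complement rule needs a measurable rejection event. It links the type II error at a
  signal indistinguishable from 0 to the level of the test.\<close>

lemma type2_error_zero:
  assumes \<xi>: "iid_std_normal M \<xi>" and Kn: "\<And>y. Kn y \<longleftrightarrow> T_stat \<sigma> \<kappa> n y > u"
  shows "type2_error M \<xi> \<sigma> \<phi> n Kn (\<lambda>t. 0) = 1 - type1_error M \<xi> \<sigma> \<phi> n Kn"
proof -
  interpret prob_space M using \<xi> by (simp add: iid_std_normal_def)
  have \<xi>m: "random_variable borel (\<xi> j)" if "j \<ge> 1" for j
    using \<xi> that by (auto simp: iid_std_normal_def indep_vars_def)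
  have "(\<lambda>\<omega>. \<Sum>\<^sub>\<infinity>j\<in>{1..}. (\<kappa> j n)\<^sup>2 * (observation \<xi> \<sigma> \<phi> n (\<lambda>t. 0) \<omega> j)\<^sup>2) \<in> borel_measurable M"
  proof (rule borel_measurable_infsum_nonneg)
    show "(\<lambda>\<omega>. (\<kappa> j n)\<^sup>2 * (observation \<xi> \<sigma> \<phi> n (\<lambda>t. 0) \<omega> j)\<^sup>2) \<in> borel_measurable M" if "j \<ge> 1" for j
      unfolding observation_def using \<xi>m[OF that] by measurable
  qed simp
  then have "{\<omega> \<in> space M. Kn (observation \<xi> \<sigma> \<phi> n (\<lambda>t. 0) \<omega>)} \<in> events"
    unfolding Kn T_stat_def by measurable
  then show ?thesis
    unfolding type2_error_def type1_error_def by (rule prob_neg)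
qed

text \<open>The constant \<open>D\<close> and the bound on \<open>n\<close> come from the weights
  alone, so they precede the quantifiers over \<open>x\<close>, \<open>y\<close>,
  \<open>\<theta>\<close> and \<open>v\<close>: one choice serves all alternatives and all critical
  values.\<close>

lemma quadratic_test_stability:
  fixes \<sigma> r C :: real
  assumes \<xi>: "iid_std_normal M \<xi>" and \<sigma>: "\<sigma> > 0" and r: "0 < r" "r < 1 / 2"
    and summ: "\<And>n. n \<ge> 1 \<Longrightarrow> (\<lambda>j. (\<kappa> j n)\<^sup>2) summable_on {1..}"
    and A: "A1 \<kappa>" "A2 \<sigma> \<kappa>" "A5 \<sigma> \<kappa>"
    and k: "filterlim (\<lambda>n. real (k_seq \<kappa> n)) at_top sequentially"
    and \<epsilon>: "\<epsilon> > 0" and C: "C > 0"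
  shows "\<exists>D\<ge>1. \<forall>\<^sub>F n in sequentially. \<forall>x y \<theta> v.
      (\<forall>j\<ge>1. real j \<le> D * real n powr (2 - 4 * r) \<longrightarrow> x j = y j) \<and>
      (\<forall>j\<ge>1. \<bar>x j\<bar> \<le> \<bar>\<theta> j\<bar> \<and> \<bar>y j\<bar> \<le> \<bar>\<theta> j\<bar> \<and> \<bar>x j - y j\<bar> \<le> \<bar>\<theta> j\<bar>) \<and>
      (\<forall>N. (\<Sum>j=1..N. (\<theta> j)\<^sup>2) \<le> (C * real n powr (- r))\<^sup>2) \<longrightarrow>
      \<bar>measure M {\<omega> \<in> space M. (\<Sum>\<^sub>\<infinity>j\<in>{1..}. (\<kappa> j n)\<^sup>2 * (x j + \<sigma> / sqrt (real n) * \<xi> j \<omega>)\<^sup>2) \<le> v}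
       - measure M {\<omega> \<in> space M. (\<Sum>\<^sub>\<infinity>j\<in>{1..}. (\<kappa> j n)\<^sup>2 * (y j + \<sigma> / sqrt (real n) * \<xi> j \<omega>)\<^sup>2) \<le> v}\<bar> \<le> \<epsilon>"
proof -
  interpret prob_space M using \<xi> by (simp add: iid_std_normal_def)
  obtain B where B: "B > 0" "\<And>n m. n \<ge> 1 \<Longrightarrow> m \<ge> 1 \<Longrightarrow> real m * (\<kappa> m n) ^ 4 \<le> B / (real n)\<^sup>2"
    using kappa_upper_bound[OF A(1,2) \<sigma>] by blast
  obtain b where b: "b > 0" and ev: "\<forall>\<^sub>F n in sequentially. \<exists>k>0. \<forall>j. 1 \<le> j \<and> j \<le> 4 * k \<longrightarrow> b / (real n)\<^sup>2 \<le> real k * (\<kappa> j n) ^ 4"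
    using kappa_lower_bound[OF A \<sigma> k] by blast
  \<comment> \<open>With window \<open>h = \<eta> / n\<^sup>2\<close> the anti-concentration term
    becomes exactly \<open>\<epsilon> / 2\<close>.\<close>
  define \<eta> where "\<eta> = \<epsilon> * \<sigma>\<^sup>2 * sqrt b / pi"
  have \<eta>: "\<eta> > 0" using \<epsilon> \<sigma> b by (simp add: \<eta>_def)
  \<comment> \<open>The middle entry keeps the deterministic shift below \<open>h / 2\<close>, the
    last one the Chebyshev term below \<open>\<epsilon> / 2\<close>; the 1 guarantees a cutoff index
    \<open>m \<ge> 1\<close>.\<close>
  define D where "D = max 1 (max (8 * B * C ^ 4 / \<eta>\<^sup>2) (64 * \<sigma>\<^sup>2 * B * C\<^sup>2 / (\<eta>\<^sup>2 * \<epsilon>)))"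
  have D: "D \<ge> 1" "8 * B * C ^ 4 / \<eta>\<^sup>2 \<le> D" "64 * \<sigma>\<^sup>2 * B * C\<^sup>2 / (\<eta>\<^sup>2 * \<epsilon>) \<le> D"
    by (auto simp: D_def)
  have D1: "B * C ^ 4 / D \<le> \<eta>\<^sup>2 / 8" using D(1,2) \<eta> by (simp add: field_simps)
  have D2: "32 * \<sigma>\<^sup>2 * B * C\<^sup>2 / (\<eta>\<^sup>2 * D) \<le> \<epsilon> / 2" using D(1,3) \<eta> \<epsilon> by (simp add: field_simps)
  show ?thesis
  proof (intro exI[of _ D] conjI D(1))
    show "\<forall>\<^sub>F n in sequentially. \<forall>x y \<theta> v.
      (\<forall>j\<ge>1. real j \<le> D * real n powr (2 - 4 * r) \<longrightarrow> x j = y j) \<and>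
      (\<forall>j\<ge>1. \<bar>x j\<bar> \<le> \<bar>\<theta> j\<bar> \<and> \<bar>y j\<bar> \<le> \<bar>\<theta> j\<bar> \<and> \<bar>x j - y j\<bar> \<le> \<bar>\<theta> j\<bar>) \<and>
      (\<forall>N. (\<Sum>j=1..N. (\<theta> j)\<^sup>2) \<le> (C * real n powr (- r))\<^sup>2) \<longrightarrow>
      \<bar>prob {\<omega> \<in> space M. (\<Sum>\<^sub>\<infinity>j\<in>{1..}. (\<kappa> j n)\<^sup>2 * (x j + \<sigma> / sqrt (real n) * \<xi> j \<omega>)\<^sup>2) \<le> v}
       - prob {\<omega> \<in> space M. (\<Sum>\<^sub>\<infinity>j\<in>{1..}. (\<kappa> j n)\<^sup>2 * (y j + \<sigma> / sqrt (real n) * \<xi> j \<omega>)\<^sup>2) \<le> v}\<bar> \<le> \<epsilon>"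
      using ev eventually_ge_at_top[of 1]
    proof (eventually_elim, intro allI impI, elim conjE)
      fix n :: nat and x y \<theta> :: "nat \<Rightarrow> real" and v :: real
      assume "\<exists>k>0. \<forall>j. 1 \<le> j \<and> j \<le> 4 * k \<longrightarrow> b / (real n)\<^sup>2 \<le> real k * (\<kappa> j n) ^ 4"
      then obtain k where k: "k > 0" "\<And>j. 1 \<le> j \<Longrightarrow> j \<le> 4 * k \<Longrightarrow> b / (real n)\<^sup>2 \<le> real k * (\<kappa> j n) ^ 4"
        by blast
      assume n: "1 \<le> n"
      assume xy: "\<forall>j\<ge>1. real j \<le> D * real n powr (2 - 4 * r) \<longrightarrow> x j = y j"
      assume \<theta>: "\<forall>j\<ge>1. \<bar>x j\<bar> \<le> \<bar>\<theta> j\<bar> \<and> \<bar>y j\<bar> \<le> \<bar>\<theta> j\<bar> \<and> \<bar>x j - y j\<bar> \<le> \<bar>\<theta> j\<bar>"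
      define \<rho> where "\<rho> = real n powr (- r)"
      define R where "R = (C * \<rho>)\<^sup>2"
      assume "\<forall>N. (\<Sum>j=1..N. (\<theta> j)\<^sup>2) \<le> (C * real n powr (- r))\<^sup>2"
      then have R: "\<And>N. (\<Sum>j=1..N. (\<theta> j)\<^sup>2) \<le> R" by (simp add: R_def \<rho>_def)
      have rn: "real n > 0" "real n \<ge> 1" using n by auto
      have \<rho>: "\<rho> > 0" using rn by (simp add: \<rho>_def)
      have p: "real n powr (2 - 4 * r) = (real n)\<^sup>2 * \<rho> ^ 4"
      proof -
        have "\<rho> ^ 4 = real n powr (- 4 * r)"
          unfolding \<rho>_def using rn by (simp add: powr_realpow[symmetric] powr_powr mult.commute)
        moreover have "real n powr (2 - 4 * r) = real n powr 2 * real n powr (- 4 * r)"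
          using powr_add[of "real n" 2 "- 4 * r"] by simp
        ultimately show ?thesis using rn by (simp add: powr_numeral)
      qed
      \<comment> \<open>The Chebyshev term carries the extra factor
        \<open>1 / (n * \<rho>\<^sup>2) = n powr (2 * r - 1)\<close>, harmless because
        \<open>r < 1 / 2\<close>.\<close>
      have n\<rho>: "1 \<le> real n * \<rho>\<^sup>2"
      proof -
        have "real n * \<rho>\<^sup>2 = real n powr 1 * real n powr (- 2 * r)"
          unfolding \<rho>_def using rn by (simp add: powr_realpow[symmetric] powr_powr mult.commute)
        also have "\<dots> = real n powr (1 - 2 * r)"
          using powr_add[of "real n" 1 "- 2 * r"] by simp
        also have "\<dots> \<ge> 1" using rn r by (intro ge_one_powr_ge_zero) auto
        finally show ?thesis .
      qed
      define m where "m = nat \<lfloor>D * real n powr (2 - 4 * r)\<rfloor>"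
      have Dp: "1 \<le> D * real n powr (2 - 4 * r)"
        using D(1) rn r by (intro mult_ge1_I ge_one_powr_ge_zero) auto
      have m: "m \<ge> 1" "D * real n powr (2 - 4 * r) \<le> 2 * real m" "real m \<le> D * real n powr (2 - 4 * r)"
      proof -
        have "real m = of_int \<lfloor>D * real n powr (2 - 4 * r)\<rfloor>" "\<lfloor>D * real n powr (2 - 4 * r)\<rfloor> \<ge> 1"
          unfolding m_def using Dp by (simp_all add: le_floor_iff)
        then show "m \<ge> 1" "D * real n powr (2 - 4 * r) \<le> 2 * real m" "real m \<le> D * real n powr (2 - 4 * r)"
          by linarith+
      qed
      define \<beta> where "\<beta> = (\<kappa> m n)\<^sup>2"
      have \<beta>0: "\<beta> \<ge> 0" by (simp add: \<beta>_def)
      \<comment> \<open>The weight at the cutoff in a form free of \<open>n\<close>. The 2 is the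
        price of the integer part in \<open>m\<close>; the factor \<open>1 / D\<close> is what makes
        both error terms small.\<close>
      have \<beta>2: "\<beta>\<^sup>2 * ((real n) ^ 4 * \<rho> ^ 4) \<le> 2 * B / D"
      proof -
        have "D * ((real n)\<^sup>2 * \<rho> ^ 4) * \<beta>\<^sup>2 \<le> 2 * real m * \<beta>\<^sup>2"
          using m(2) unfolding p by (rule mult_right_mono) simp
        also have "\<dots> = 2 * (real m * (\<kappa> m n) ^ 4)" by (simp add: \<beta>_def flip: power_mult)
        also have "\<dots> \<le> 2 * (B / (real n)\<^sup>2)" using B(2)[OF n m(1)] by simp
        finally have "D * ((real n)\<^sup>2 * \<rho> ^ 4) * \<beta>\<^sup>2 * (real n)\<^sup>2 \<le> 2 * B"
          using rn by (simp add: field_simps)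
        then show ?thesis using D(1) by (simp add: field_simps power2_eq_square power4_eq_xxxx)
      qed
      define h where "h = \<eta> / (real n)\<^sup>2"
      have h: "h > 0" using \<eta> rn by (simp add: h_def)
      have bR: "\<beta> * R \<le> h / 2"
      proof (rule power2_le_imp_le)
        have "(\<beta> * R)\<^sup>2 * (real n) ^ 4 = C ^ 4 * (\<beta>\<^sup>2 * ((real n) ^ 4 * \<rho> ^ 4))"
          by (simp add: R_def power_mult_distrib flip: power_mult)
        also have "\<dots> \<le> C ^ 4 * (2 * B / D)" using \<beta>2 by (intro mult_left_mono) auto
        also have "\<dots> \<le> \<eta>\<^sup>2 / 4" using D1 by (simp add: mult.commute)
        finally show "(\<beta> * R)\<^sup>2 \<le> (h / 2)\<^sup>2"
          unfolding h_def using rn by (simp add: power_divide field_simps flip: power_mult)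
      qed (use h in simp)
      \<comment> \<open>A lower bound for the leading weights times the noise variance. In
        \<open>a * sqrt k\<close> the number \<open>k\<close> cancels, leaving order
        \<open>1 / n\<^sup>2\<close>, so the size of \<open>k\<close> never has to be known.\<close>
      define a where "a = \<sigma>\<^sup>2 * sqrt b / ((real n)\<^sup>2 * sqrt k)"
      have a: "a > 0" using \<sigma> b rn k(1) by (simp add: a_def)
      have a_le: "a \<le> (\<kappa> j n)\<^sup>2 * (\<sigma> / sqrt (real n))\<^sup>2" if j: "1 \<le> j" "j \<le> 4 * k" for j
      proof -
        have "b / ((real n)\<^sup>2 * real k) \<le> ((\<kappa> j n)\<^sup>2)\<^sup>2"
          using k(2)[OF j] k(1) rn by (simp add: field_simps flip: power_mult)
        then have "sqrt (b / ((real n)\<^sup>2 * real k)) \<le> (\<kappa> j n)\<^sup>2" by (rule real_le_lsqrt[rotated -1]) auto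
        then have "sqrt b / (real n * sqrt k) \<le> (\<kappa> j n)\<^sup>2" using rn by (simp add: real_sqrt_divide real_sqrt_mult)
        then have "sqrt b / (real n * sqrt k) * (\<sigma>\<^sup>2 / real n) \<le> (\<kappa> j n)\<^sup>2 * (\<sigma>\<^sup>2 / real n)"
          by (rule mult_right_mono) simp
        then show ?thesis using rn by (simp add: a_def power_divide power2_eq_square ac_simps)
      qed
      have wk: "(\<kappa> j n)\<^sup>2 \<le> \<beta>" if "j \<ge> m" for j
        unfolding \<beta>_def by (rule kappa_antimono[OF A(1) n m(1) that])
      have "\<bar>prob {\<omega> \<in> space M. (\<Sum>\<^sub>\<infinity>j\<in>{1..}. (\<kappa> j n)\<^sup>2 * (x j + \<sigma> / sqrt (real n) * \<xi> j \<omega>)\<^sup>2) \<le> v}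
         - prob {\<omega> \<in> space M. (\<Sum>\<^sub>\<infinity>j\<in>{1..}. (\<kappa> j n)\<^sup>2 * (y j + \<sigma> / sqrt (real n) * \<xi> j \<omega>)\<^sup>2) \<le> v}\<bar>
         \<le> h * pi / (2 * a * sqrt k) + 16 * (\<sigma> / sqrt (real n))\<^sup>2 * \<beta>\<^sup>2 * R / h\<^sup>2"
      proof (rule noncentral_chi_square_shift_infsum[where \<theta> = \<theta>])
        show "x j = y j \<or> (\<kappa> j n)\<^sup>2 \<le> \<beta>" if "j \<ge> 1" for j
        proof (cases "j \<le> m")
          case True
          then have "real j \<le> D * real n powr (2 - 4 * r)" using m(3) by linarith
          then show ?thesis using xy that by blast
        qed (use wk in simp)
        show "\<sigma> / sqrt (real n) \<noteq> 0" using \<sigma> rn by simp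
      qed (use \<xi> k(1) a h a_le summ[OF n] \<theta> R \<beta>0 bR in \<open>auto simp: iid_std_normal_def\<close>)
      also have "h * pi / (2 * a * sqrt k) = \<epsilon> / 2"
        using \<sigma> b rn k(1) by (simp add: h_def a_def \<eta>_def field_simps)
      also have "16 * (\<sigma> / sqrt (real n))\<^sup>2 * \<beta>\<^sup>2 * R / h\<^sup>2 \<le> \<epsilon> / 2"
      proof -
        have "16 * (\<sigma> / sqrt (real n))\<^sup>2 * \<beta>\<^sup>2 * R / h\<^sup>2
            = 16 * \<sigma>\<^sup>2 * C\<^sup>2 / \<eta>\<^sup>2 * (\<beta>\<^sup>2 * ((real n) ^ 4 * \<rho> ^ 4)) * (1 / (real n * \<rho>\<^sup>2))"
          using rn \<rho> \<eta> by (simp add: R_def h_def power_divide power_mult_distrib field_simps power2_eq_square power4_eq_xxxx)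
        also have "\<dots> \<le> 16 * \<sigma>\<^sup>2 * C\<^sup>2 / \<eta>\<^sup>2 * (2 * B / D) * 1"
          using \<beta>2 n\<rho> B(1) D(1) by (intro mult_mono mult_left_mono) auto
        also have "\<dots> = 32 * \<sigma>\<^sup>2 * B * C\<^sup>2 / (\<eta>\<^sup>2 * D)" by simp
        finally show ?thesis using D2 by linarith
      qed
      finally show "\<bar>prob {\<omega> \<in> space M. (\<Sum>\<^sub>\<infinity>j\<in>{1..}. (\<kappa> j n)\<^sup>2 * (x j + \<sigma> / sqrt (real n) * \<xi> j \<omega>)\<^sup>2) \<le> v}
         - prob {\<omega> \<in> space M. (\<Sum>\<^sub>\<infinity>j\<in>{1..}. (\<kappa> j n)\<^sup>2 * (y j + \<sigma> / sqrt (real n) * \<xi> j \<omega>)\<^sup>2) \<le> v}\<bar> \<le> \<epsilon>"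
        by simp
    qed
  qed
qed

theorem theorem4p3:
  fixes M :: "'w measure" and \<xi> :: "nat \<Rightarrow> 'w \<Rightarrow> real"
    and \<phi> :: "nat \<Rightarrow> real \<Rightarrow> real" and \<kappa> :: "nat \<Rightarrow> nat \<Rightarrow> real"
    and \<sigma> r s P0 \<alpha> :: real and K :: "nat \<Rightarrow> test"
  assumes noise: "iid_std_normal M \<xi>" "\<sigma> > 0"
    and basis: "orthonormal_basis \<phi>"
    and kappa_summable: "\<And>n. n \<ge> 1 \<Longrightarrow> (\<lambda>j. (\<kappa> j n)\<^sup>2) summable_on {1..}"
    and A: "A1 \<kappa>" "A2 \<sigma> \<kappa>" "A3 \<kappa>" "A4 \<kappa>" "A5 \<sigma> \<kappa>"
    and r: "0 < r" "r < 1 / 2"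
    and k: "asymp_order (\<lambda>n. real (k_seq \<kappa> n)) (\<lambda>n. real n powr (2 - 4 * r))"
    and s: "s = r / (2 - 4 * r)"
    and P0: "P0 > 0"
    and alpha: "0 < \<alpha>" "\<alpha> < 1"
    and K: "generated_tests \<sigma> \<kappa> K"
      "(\<lambda>n. type1_error M \<xi> \<sigma> \<phi> n (K n)) \<sim>[sequentially] (\<lambda>n. \<alpha>)"
  shows "\<forall>\<epsilon>>0. \<forall>c C. 0 < c \<and> c < C \<longrightarrow>
    (\<exists>\<gamma>\<^sub>\<epsilon>>0. \<exists>n\<^sub>\<epsilon>::nat. n\<^sub>\<epsilon> \<ge> 1 \<and>
      (\<forall>f :: nat \<Rightarrow> real \<Rightarrow> real.
        (\<forall>n\<ge>1. f n \<in> L2_01 \<and>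
           c * real n powr (- r) \<le> L2_norm (f n) \<and> L2_norm (f n) \<le> C * real n powr (- r)) \<and>
        consistent_alternatives M \<xi> \<sigma> \<phi> \<kappa> f \<longrightarrow>
        (\<forall>n>n\<^sub>\<epsilon>. \<forall>\<gamma>>\<gamma>\<^sub>\<epsilon>. \<forall>f\<^sub>n\<^sub>\<gamma>.
           nearest_point (dilate \<gamma> (Besov_ball \<phi> s P0)) (f n) f\<^sub>n\<^sub>\<gamma> \<longrightarrow>
           \<bar>type2_error M \<xi> \<sigma> \<phi> n (K n) (f n) - type2_error M \<xi> \<sigma> \<phi> n (K n) f\<^sub>n\<^sub>\<gamma>\<bar> \<le> \<epsilon> \<and>
           type2_error M \<xi> \<sigma> \<phi> n (K n) (\<lambda>t. f n t - f\<^sub>n\<^sub>\<gamma> t) \<ge> 1 - \<alpha> - \<epsilon>)))"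
proof (intro allI impI)
  fix \<epsilon> c C :: real
  assume \<epsilon>: "0 < \<epsilon>" and cC: "0 < c \<and> c < C"
  \<comment> \<open>This half of the order relation bounds \<open>k_seq\<close> from below by a
    multiple of \<open>n powr (2 - 4 * r)\<close>, which tends to infinity as
    \<open>r < 1 / 2\<close>.\<close>
  obtain Ck where Ck: "Ck > 0" "\<And>n. n \<ge> 1 \<Longrightarrow> real n powr (2 - 4 * r) \<le> Ck * real (k_seq \<kappa> n)"
    using k unfolding asymp_order_def by (meson less_le_trans)
  have k_top: "filterlim (\<lambda>n. real (k_seq \<kappa> n)) at_top sequentially"
  proof (rule filterlim_at_top_mono)
    have "filterlim (\<lambda>n. exp ((2 - 4 * r) * ln (real n))) at_top sequentially"
      using r by (intro filterlim_compose[OF exp_at_top] filterlim_tendsto_pos_mult_at_top[OF tendsto_const]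
        filterlim_compose[OF ln_at_top] filterlim_real_sequentially) simp
    then show "filterlim (\<lambda>n. inverse Ck * exp ((2 - 4 * r) * ln (real n))) at_top sequentially"
      using Ck(1) by (intro filterlim_tendsto_pos_mult_at_top[OF tendsto_const]) auto
    show "\<forall>\<^sub>F n in sequentially. inverse Ck * exp ((2 - 4 * r) * ln (real n)) \<le> real (k_seq \<kappa> n)"
      using eventually_ge_at_top[of 1]
    proof eventually_elim
      case (elim n)
      then show ?case using Ck(1) Ck(2)[OF elim] by (simp add: powr_def field_simps)
    qed
  qed
  let ?P = "\<lambda>n x v. measure M {\<omega> \<in> space M. (\<Sum>\<^sub>\<infinity>j\<in>{1..}. (\<kappa> j n)\<^sup>2 * (x j + \<sigma> / sqrt (real n) * \<xi> j \<omega>)\<^sup>2) \<le> v}"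
  obtain D where D: "D \<ge> 1" and ev: "\<forall>\<^sub>F n in sequentially. \<forall>x y \<theta> v.
      (\<forall>j\<ge>1. real j \<le> D * real n powr (2 - 4 * r) \<longrightarrow> x j = y j) \<and>
      (\<forall>j\<ge>1. \<bar>x j\<bar> \<le> \<bar>\<theta> j\<bar> \<and> \<bar>y j\<bar> \<le> \<bar>\<theta> j\<bar> \<and> \<bar>x j - y j\<bar> \<le> \<bar>\<theta> j\<bar>) \<and>
      (\<forall>N. (\<Sum>j=1..N. (\<theta> j)\<^sup>2) \<le> (C * real n powr (- r))\<^sup>2) \<longrightarrow>
      \<bar>?P n x v - ?P n y v\<bar> \<le> \<epsilon> / 2"
    using quadratic_test_stability[OF noise r kappa_summable A(1,2,5) k_top, of "\<epsilon> / 2" C] \<epsilon> cC by auto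
  have "(\<lambda>n. type1_error M \<xi> \<sigma> \<phi> n (K n)) \<longlonglongrightarrow> \<alpha>"
    using tendsto_asymp_equiv_cong[OF K(2), of \<alpha>] by simp
  \<comment> \<open>An upper bound suffices: the type II error at 0 is one minus this quantity, and
    the second claim bounds a type II error from below.\<close>
  then have ev1: "\<forall>\<^sub>F n in sequentially. type1_error M \<xi> \<sigma> \<phi> n (K n) < \<alpha> + \<epsilon> / 2"
    using \<epsilon> by (intro order_tendstoD(2)) auto
  obtain n0 where n0: "\<And>n x y \<theta> v. n \<ge> n0 \<Longrightarrow>
      (\<And>j. j \<ge> 1 \<Longrightarrow> real j \<le> D * real n powr (2 - 4 * r) \<Longrightarrow> x j = y j) \<Longrightarrow>
      (\<And>j. j \<ge> 1 \<Longrightarrow> \<bar>x j\<bar> \<le> \<bar>\<theta> j\<bar> \<and> \<bar>y j\<bar> \<le> \<bar>\<theta> j\<bar> \<and> \<bar>x j - y j\<bar> \<le> \<bar>\<theta> j\<bar>) \<Longrightarrow>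
      (\<And>N. (\<Sum>j=1..N. (\<theta> j)\<^sup>2) \<le> (C * real n powr (- r))\<^sup>2) \<Longrightarrow>
      \<bar>?P n x v - ?P n y v\<bar> \<le> \<epsilon> / 2"
    "\<And>n. n \<ge> n0 \<Longrightarrow> type1_error M \<xi> \<sigma> \<phi> n (K n) < \<alpha> + \<epsilon> / 2"
  proof -
    from eventually_conj[OF ev ev1] obtain n1 where n1: "\<And>n. n \<ge> n1 \<Longrightarrow> (\<forall>x y \<theta> v.
      (\<forall>j\<ge>1. real j \<le> D * real n powr (2 - 4 * r) \<longrightarrow> x j = y j) \<and>
      (\<forall>j\<ge>1. \<bar>x j\<bar> \<le> \<bar>\<theta> j\<bar> \<and> \<bar>y j\<bar> \<le> \<bar>\<theta> j\<bar> \<and> \<bar>x j - y j\<bar> \<le> \<bar>\<theta> j\<bar>) \<and>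
      (\<forall>N. (\<Sum>j=1..N. (\<theta> j)\<^sup>2) \<le> (C * real n powr (- r))\<^sup>2) \<longrightarrow>
      \<bar>?P n x v - ?P n y v\<bar> \<le> \<epsilon> / 2) \<and> type1_error M \<xi> \<sigma> \<phi> n (K n) < \<alpha> + \<epsilon> / 2"
      unfolding eventually_sequentially by blast
    show ?thesis
      by (rule that[of n1]) (use n1 in blast)+
  qed
  have s0: "s > 0" using s r by simp
  \<comment> \<open>Solves \<open>\<gamma>0\<^sup>2 * P0 = D powr (2 * s) * C\<^sup>2\<close>. At
    indices up to \<open>D * n powr (2 - 4 * r)\<close> the identity
    \<open>(2 - 4 * r) * (2 * s) = 2 * r\<close> cancels the \<open>n powr (- 2 * r)\<close> in the
    squared norm, so \<open>n\<close> drops out.\<close>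
  define \<gamma>0 where "\<gamma>0 = sqrt (D powr (2 * s) * C\<^sup>2 / P0)"
  have \<gamma>0: "\<gamma>0 > 0" using D cC P0 by (simp add: \<gamma>0_def)
  show "\<exists>\<gamma>\<^sub>\<epsilon>>0. \<exists>n\<^sub>\<epsilon>::nat. n\<^sub>\<epsilon> \<ge> 1 \<and>
      (\<forall>f :: nat \<Rightarrow> real \<Rightarrow> real.
        (\<forall>n\<ge>1. f n \<in> L2_01 \<and>
           c * real n powr (- r) \<le> L2_norm (f n) \<and> L2_norm (f n) \<le> C * real n powr (- r)) \<and>
        consistent_alternatives M \<xi> \<sigma> \<phi> \<kappa> f \<longrightarrow>
        (\<forall>n>n\<^sub>\<epsilon>. \<forall>\<gamma>>\<gamma>\<^sub>\<epsilon>. \<forall>f\<^sub>n\<^sub>\<gamma>.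
           nearest_point (dilate \<gamma> (Besov_ball \<phi> s P0)) (f n) f\<^sub>n\<^sub>\<gamma> \<longrightarrow>
           \<bar>type2_error M \<xi> \<sigma> \<phi> n (K n) (f n) - type2_error M \<xi> \<sigma> \<phi> n (K n) f\<^sub>n\<^sub>\<gamma>\<bar> \<le> \<epsilon> \<and>
           type2_error M \<xi> \<sigma> \<phi> n (K n) (\<lambda>t. f n t - f\<^sub>n\<^sub>\<gamma> t) \<ge> 1 - \<alpha> - \<epsilon>))"
  proof (intro exI[of _ \<gamma>0] exI[of _ "max 1 n0"] conjI[of "\<gamma>0 > 0"] conjI[of "max 1 n0 \<ge> 1"] \<gamma>0 allI impI)
    fix f :: "nat \<Rightarrow> real \<Rightarrow> real" and n :: nat and \<gamma> :: real and g :: "real \<Rightarrow> real"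
    assume "(\<forall>n\<ge>1. f n \<in> L2_01 \<and>
           c * real n powr (- r) \<le> L2_norm (f n) \<and> L2_norm (f n) \<le> C * real n powr (- r)) \<and>
        consistent_alternatives M \<xi> \<sigma> \<phi> \<kappa> f"
      and nn: "max 1 n0 < n" and \<gamma>: "\<gamma>0 < \<gamma>"
      and g: "nearest_point (dilate \<gamma> (Besov_ball \<phi> s P0)) (f n) g"
    then have fL: "f n \<in> L2_01" and fC: "L2_norm (f n) \<le> C * real n powr (- r)" by auto
    have n: "n \<ge> 1" "n \<ge> n0" using nn by auto
    have \<gamma>p: "\<gamma> > 0" using \<gamma> \<gamma>0 by linarith
    have gL: "g \<in> L2_01"
      using g dilate_Besov_ball_iff[OF basis \<gamma>p, of g s P0] by (simp add: nearest_point_def)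
    have \<gamma>2: "D powr (2 * s) * C\<^sup>2 \<le> \<gamma>\<^sup>2 * P0"
    proof -
      have "\<gamma>0\<^sup>2 \<le> \<gamma>\<^sup>2" using \<gamma> \<gamma>0 by (intro power_mono) auto
      moreover have "\<gamma>0\<^sup>2 = D powr (2 * s) * C\<^sup>2 / P0" unfolding \<gamma>0_def using P0 by simp
      ultimately show ?thesis using P0 by (simp add: field_simps)
    qed
    have m: "real j powr (2 * s) * (L2_norm (f n))\<^sup>2 \<le> \<gamma>\<^sup>2 * P0" if j: "real j \<le> D * real n powr (2 - 4 * r)" for j
    proof -
      have "real j powr (2 * s) * (L2_norm (f n))\<^sup>2 \<le> (D * real n powr (2 - 4 * r)) powr (2 * s) * (C * real n powr (- r))\<^sup>2"
        using j s0 fC by (intro mult_mono powr_mono2 power_mono L2_norm_nonneg) auto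
      also have "\<dots> = D powr (2 * s) * C\<^sup>2 * (real n powr ((2 - 4 * r) * (2 * s)) * (real n powr (- r))\<^sup>2)"
        using D by (simp add: powr_mult powr_powr power_mult_distrib)
      also have "(2 - 4 * r) * (2 * s) = 2 * r"
      proof -
        have "2 - 4 * r \<noteq> 0" using r by simp
        then show ?thesis unfolding s by simp
      qed
      also have "real n powr (2 * r) * (real n powr (- r))\<^sup>2 = 1"
        using n by (simp add: power2_eq_square powr_add[symmetric])
      finally show ?thesis using \<gamma>2 by simp
    qed
    let ?x = "\<lambda>j. L2_inner (f n) (\<phi> j)" and ?y = "\<lambda>j. L2_inner g (\<phi> j)"
    \<comment> \<open>Since \<open>0 powr (2 * s) = 0\<close>, the cutoff 0 is always admissible; it
      gives the domination at all indices.\<close>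
    have m0: "real 0 powr (2 * s) * (L2_norm (f n))\<^sup>2 \<le> \<gamma>\<^sup>2 * P0" using P0 by simp
    note near = nearest_point_Besov_ball[OF basis fL \<gamma>p s0 g]
    \<comment> \<open>The nearest point lemma is applied with the cutoff \<open>m\<close> equal to
      \<open>j\<close> itself, separately for each index in range.\<close>
    have xy: "?x j = ?y j" if "j \<ge> 1" "real j \<le> D * real n powr (2 - 4 * r)" for j
      using near(3)[OF m[OF that(2)] that(1)] by simp
    have dom: "\<bar>?y j\<bar> \<le> \<bar>?x j\<bar> \<and> \<bar>?x j - ?y j\<bar> \<le> \<bar>?x j\<bar>" if "j \<ge> 1" for j
      using near(1,2)[OF m0 that] by simp
    have R: "(\<Sum>j=1..N. (?x j)\<^sup>2) \<le> (C * real n powr (- r))\<^sup>2" for N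
      using L2_Bessel[OF basis fL, of N] power_mono[OF fC L2_norm_nonneg, of 2] by linarith
    obtain u where u: "\<And>y. K n y \<longleftrightarrow> T_stat \<sigma> \<kappa> n y > u"
      using K(1) n unfolding generated_tests_def by blast
    note t2 = type2_error_eq_prob_infsum[where Kn = "K n", OF u, of M \<xi> \<phi>]
    have "\<bar>type2_error M \<xi> \<sigma> \<phi> n (K n) (f n) - type2_error M \<xi> \<sigma> \<phi> n (K n) g\<bar> \<le> \<epsilon> / 2"
      unfolding t2 by (rule n0(1)[OF n(2), where \<theta> = ?x]) (use xy dom R in auto)
    \<comment> \<open>Up to the cutoff the coordinates of the difference vanish, and beyond it they
      are dominated by those of \<open>f n\<close>, so the difference can be compared with the zero
      signal under the same envelope. Its error \<open>\<epsilon> / 2\<close> and the one in the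
      level add up to \<epsilon>.\<close>
    moreover have "\<bar>type2_error M \<xi> \<sigma> \<phi> n (K n) (\<lambda>t. f n t - g t) - type2_error M \<xi> \<sigma> \<phi> n (K n) (\<lambda>t. 0)\<bar> \<le> \<epsilon> / 2"
      unfolding t2
    proof (rule n0(1)[OF n(2), where \<theta> = ?x])
      have d: "L2_inner (\<lambda>t. f n t - g t) (\<phi> j) = ?x j - ?y j" if "j \<ge> 1" for j
        by (rule L2_inner_diff[OF fL gL orthonormal_basisD(1)[OF basis that]])
      show "L2_inner (\<lambda>t. f n t - g t) (\<phi> j) = L2_inner (\<lambda>t. 0) (\<phi> j)"
        if "j \<ge> 1" "real j \<le> D * real n powr (2 - 4 * r)" for j
        using d[OF that(1)] xy[OF that] by (simp add: L2_inner_zero_left)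
      show "\<bar>L2_inner (\<lambda>t. f n t - g t) (\<phi> j)\<bar> \<le> \<bar>?x j\<bar> \<and> \<bar>L2_inner (\<lambda>t. 0) (\<phi> j)\<bar> \<le> \<bar>?x j\<bar> \<and>
          \<bar>L2_inner (\<lambda>t. f n t - g t) (\<phi> j) - L2_inner (\<lambda>t. 0) (\<phi> j)\<bar> \<le> \<bar>?x j\<bar>" if "j \<ge> 1" for j
        using d[OF that] dom[OF that] by (simp add: L2_inner_zero_left)
    qed (rule R)
    ultimately show "\<bar>type2_error M \<xi> \<sigma> \<phi> n (K n) (f n) - type2_error M \<xi> \<sigma> \<phi> n (K n) g\<bar> \<le> \<epsilon> \<and>
        type2_error M \<xi> \<sigma> \<phi> n (K n) (\<lambda>t. f n t - g t) \<ge> 1 - \<alpha> - \<epsilon>"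
      using type2_error_zero[where Kn = "K n" and \<phi> = \<phi>, OF noise(1) u] n0(2)[OF n(2)] \<epsilon> by linarith
  qed simp
qed

end
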